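(* Fix $\ell\in\mathbb{N}$, and let $\kappa_\ell$ be the smallest absolute constant such that $$\Big|\frac{(N-n)!}{N!}\mathrm{Per}(Z)-H_\ell(Z)\Big|\le\kappa_\ell\,\gamma^{(\ell+1)/2}$$ holds for all $N\in\mathbb{N}$, all $n\in\{1,\dots,N\}$ with $\ell\le n$, and all $Z=(z_{j,k})\in\mathbb{C}^{N\times n}$ with $|z_{j,k}|\le1$ for all $j,k$ (without any restriction on $\gamma$), where $\gamma=\gamma(Z)$ and $H_\ell(Z)$ are defined in the context. Then $$\kappa_\ell\le\frac{(\ell+1)^{1/4}\,C_{\ell+1}}{(1-x_\ell)^{3/4}},$$ where $x_\ell\in(0,1)$ is the unique positive solution of the equation $$2+2^{1/4}C_2\,x\Big(\frac{1-x^{\ell-1}}{1-x}\Big)^{3/4}=(\ell+1)^{1/4}\,C_{\ell+1}\,\frac{x^{(\ell+1)/2}}{(1-x)^{3/4}},\qquad x\in(0,1).$$ In particular, $\kappa_1\le3.57$, $\kappa_2\le5.53$ and $\kappa_3\le7.08$.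
   Context: For $r\in\mathbb{N}=\{1,2,\dots\}$, $C_r=\Big(\frac{\mathrm{e}^r\,r!}{r^{r+1/2}}\Big)^{1/2}$. The permanent of a rectangular matrix $Z=(z_{j,k})\in\mathbb{C}^{N\times n}$, $n\le N$, is $\mathrm{Per}(Z)=\sum\prod_{k=1}^n z_{j_k,k}$, the sum being over all $(j_1,\dots,j_n)\in\{1,\dots,N\}^n$ with pairwise distinct entries. For such $Z$ with $|z_{j,k}|\le 1$ set $\widetilde z_k=\frac1N\sum_{j=1}^N z_{j,k}$, $a_{j,k}=z_{j,k}-\widetilde z_k$, and, for indeterminates $x=(x_1,\dots,x_n)$, $U_j(x)=\sum_{k=1}^n a_{j,k}x_k$. Put $$\alpha=\frac{1}{nN}\sum_{j=1}^N\sum_{k=1}^n|a_{j,k}|^2,\qquad \beta=\frac1n\sum_{k=1}^n|\widetilde z_k|^2,\qquad \gamma=\frac{n\alpha}{N}\min\Big\{n,\frac{1}{1-\beta}\Big\},$$ $$G_m(Z)=\frac{(N-m)!}{(n-m)!\,N!}\,\mathrm{Coeff}\Big(x_1\cdots x_n;\ \Big(\prod_{j=1}^N(1+U_j(x))\Big)\Big(\sum_{k=1}^n\widetilde z_kx_k\Big)^{n-m}\Big),\qquad m\in\{0,\dots,n\},$$ where $\mathrm{Coeff}(x_1\cdots x_n;\,p)$ denotes the coefficient of the monomial $x_1x_2\cdots x_n$ in the polynomial $p$, and $H_\ell(Z)=\sum_{m=0}^{\ell}G_m(Z)$ for $\ell\in\{1,\dots,n\}$. Conventions: $0^0=1$;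 the zeroth power of a polynomial is $1$; $\frac{1}{1-\beta}$ is read as $+\infty$ if $\beta=1$. *)

theory Defs
  imports Complex_Main "HOL-Library.FuncSet" "HOL-Library.Poly_Mapping"
begin

text \<open>
  An \<open>N \<times> n\<close> complex matrix is a function \<open>Z :: nat \<Rightarrow> nat \<Rightarrow> complex\<close> of which only the entries
  \<open>Z j k\<close> with \<open>j \<in> {1..N}\<close> and \<open>k \<in> {1..n}\<close> are used.
\<close>

definition C :: "nat \<Rightarrow> real" where
  "C r = sqrt (exp (real r) * fact r / real r powr (real r + 1 / 2))"

definition Per :: "nat \<Rightarrow> nat \<Rightarrow> (nat \<Rightarrow> nat \<Rightarrow> complex) \<Rightarrow> complex" where
  "Per N n Z =
     (\<Sum>j \<in> {j \<in> {1..n} \<rightarrow>\<^sub>E {1..N}. inj_on j {1..n}}. \<Prod>k\<in>{1..n}. Z (j k) k)"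

definition zbar :: "nat \<Rightarrow> (nat \<Rightarrow> nat \<Rightarrow> complex) \<Rightarrow> nat \<Rightarrow> complex" where
  "zbar N Z k = (1 / of_nat N) * (\<Sum>j\<in>{1..N}. Z j k)"

definition acoef :: "nat \<Rightarrow> (nat \<Rightarrow> nat \<Rightarrow> complex) \<Rightarrow> nat \<Rightarrow> nat \<Rightarrow> complex" where
  "acoef N Z j k = Z j k - zbar N Z k"

definition alpha :: "nat \<Rightarrow> nat \<Rightarrow> (nat \<Rightarrow> nat \<Rightarrow> complex) \<Rightarrow> real" where
  "alpha N n Z =
     1 / (real n * real N) * (\<Sum>j\<in>{1..N}. \<Sum>k\<in>{1..n}. (cmod (acoef N Z j k))\<^sup>2)"

definition beta :: "nat \<Rightarrow> nat \<Rightarrow> (nat \<Rightarrow> nat \<Rightarrow> complex) \<Rightarrow> real" where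
  "beta N n Z = 1 / real n * (\<Sum>k\<in>{1..n}. (cmod (zbar N Z k))\<^sup>2)"

text \<open>
  The convention \<open>1 / (1 - \<beta>) = \<infinity>\<close> for \<open>\<beta> = 1\<close> makes the minimum equal to \<open>n\<close> in that case;
  it is spelled out because division by zero yields zero here.
\<close>

definition gamma :: "nat \<Rightarrow> nat \<Rightarrow> (nat \<Rightarrow> nat \<Rightarrow> complex) \<Rightarrow> real" where
  "gamma N n Z =
     real n * alpha N n Z / real N *
     (if beta N n Z = 1 then real n else min (real n) (1 / (1 - beta N n Z)))"

text \<open>
  Polynomials in the indeterminates \<open>x\<^sub>1, x\<^sub>2, \<dots>\<close> are finitely supported maps from exponent vectors
  to coefficients, with the convolution product of \<^theory>\<open>HOL-Library.Poly_Mapping\<close>.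
  The term \<open>c x\<^sub>k\<close> is the map with value \<open>c\<close> at the \<open>k\<close>-th unit exponent vector, and zero elsewhere.
\<close>

type_synonym mpoly = "(nat \<Rightarrow>\<^sub>0 nat) \<Rightarrow>\<^sub>0 complex"

definition linear_form :: "nat \<Rightarrow> (nat \<Rightarrow> complex) \<Rightarrow> mpoly" where
  "linear_form n c = (\<Sum>k\<in>{1..n}. Poly_Mapping.single (Poly_Mapping.single k 1) (c k))"

definition coeff_all :: "nat \<Rightarrow> mpoly \<Rightarrow> complex" \<comment> \<open>the coefficient of \<open>x\<^sub>1 \<cdots> x\<^sub>n\<close>\<close> where
  "coeff_all n p = Poly_Mapping.lookup p (\<Sum>k\<in>{1..n}. Poly_Mapping.single k 1)"

definition U :: "nat \<Rightarrow> nat \<Rightarrow> (nat \<Rightarrow> nat \<Rightarrow> complex) \<Rightarrow> nat \<Rightarrow> mpoly" where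
  "U N n Z j = linear_form n (acoef N Z j)"

definition G :: "nat \<Rightarrow> nat \<Rightarrow> (nat \<Rightarrow> nat \<Rightarrow> complex) \<Rightarrow> nat \<Rightarrow> complex" where
  "G N n Z m =
     fact (N - m) / (fact (n - m) * fact N) *
     coeff_all n ((\<Prod>j\<in>{1..N}. 1 + U N n Z j) * linear_form n (zbar N Z) ^ (n - m))"

definition H :: "nat \<Rightarrow> nat \<Rightarrow> (nat \<Rightarrow> nat \<Rightarrow> complex) \<Rightarrow> nat \<Rightarrow> complex" where
  "H N n Z l = (\<Sum>m\<in>{0..l}. G N n Z m)"

definition admissible :: "nat \<Rightarrow> real set" where
  "admissible l = {c. \<forall>N n Z.
     1 \<le> N \<and> n \<in> {1..N} \<and> l \<le> n \<and> (\<forall>j\<in>{1..N}. \<forall>k\<in>{1..n}. cmod (Z j k) \<le> 1) \<longrightarrow>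
     cmod (fact (N - n) / fact N * Per N n Z - H N n Z l)
       \<le> c * gamma N n Z powr (real (l + 1) / 2)}"

definition kappa :: "nat \<Rightarrow> real" where
  "kappa l = (LEAST c. c \<in> admissible l)"

definition solves_eq :: "nat \<Rightarrow> real \<Rightarrow> bool" where
  "solves_eq l x \<longleftrightarrow>
     2 + 2 powr (1 / 4) * C 2 * x * ((1 - x ^ (l - 1)) / (1 - x)) powr (3 / 4)
     = real (l + 1) powr (1 / 4) * C (l + 1) * (x powr (real (l + 1) / 2) / (1 - x) powr (3 / 4))"

definition xsol :: "nat \<Rightarrow> real" where
  "xsol l = (THE x. x \<in> {0<..<1} \<and> solves_eq l x)"

end

theory Submission
  imports Defs "HOL-Complex_Analysis.Cauchy_Integral_Formula"
begin

text \<open>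
  Write \<open>P(S)\<close> for the permanent of the columns \<open>S\<close> of the centered matrix \<open>(a\<^sub>j\<^sub>k)\<close>. Extracting the
  coefficient of \<open>x\<^sub>1 \<cdots> x\<^sub>n\<close> turns \<open>G\<^sub>m\<close> into \<open>(N - m)! / N!\<close> times the sum, over the sets \<open>S\<close> of \<open>m\<close>
  columns, of \<open>P(S)\<close> times the column means outside \<open>S\<close> (\<open>G_eq\<close>). Expanding the permanent of
  \<open>a\<^sub>j\<^sub>k + mean\<^sub>k\<close> column by column shows that the normalized permanent of \<open>Z\<close> is the sum of all
  \<open>G\<^sub>m\<close> (\<open>Per_eq_sum_G\<close>), so the error consists of the terms with \<open>m > l\<close>. Moreover \<open>G\<^sub>1 = 0\<close>.

  The heart of the matter is a sharp bound on \<open>P(S)\<close>. For \<open>m\<close> equal columns \<open>u\<close> with entries summing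
  to zero, \<open>P(S)\<close> is \<open>m!\<close> times the elementary symmetric polynomial \<open>e\<^sub>m(u)\<close>, a coefficient of the
  polynomial \<open>\<Prod>\<^sub>j (w + z u\<^sub>j)\<close>. Cauchy's inequality on a circle \<open>|z| = r\<close> and the inequality of the
  arithmetic and geometric means bound it, because the linear terms of \<open>|w + z u\<^sub>j|\<^sup>2\<close> cancel in
  the sum (\<open>norm_esym_le\<close>). The permanent is a symmetric multilinear form of its columns, and on a
  Hilbert space such a form has the same norm as its restriction to the diagonal; this theorem of
  Banach (\<open>banach_norm_bound\<close>) carries the estimate over to distinct columns, without any loss in the
  constant. With the inequalities of Cauchy-Schwarz and Maclaurin one arrives at
  \<open>|G\<^sub>m|\<^sup>2 \<le> C\<^sub>m\<^sup>2 m\<^sup>1\<^sup>/\<^sup>2 (n \<alpha> / N)\<^sup>m binom(n, m) \<beta>\<^sup>n\<^sup>-\<^sup>m\<close> (\<open>norm_G_le\<close>). The factors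
  \<open>binom(n, m) \<beta>\<^sup>n\<^sup>-\<^sup>m (1 - \<beta>)\<^sup>m\<close> are binomial probabilities; summing with Cauchy-Schwarz once more gives
  a bound for a block of \<open>r\<close> consecutive terms, starting at \<open>p \<ge> 2\<close>, by
  \<open>p\<^sup>1\<^sup>/\<^sup>4 C\<^sub>p \<gamma>\<^sup>p\<^sup>/\<^sup>2 (1 + \<gamma> + \<dots> + \<gamma>\<^sup>r\<^sup>-\<^sup>1)\<^sup>3\<^sup>/\<^sup>4\<close> (\<open>sum_G_le\<close>).

  One always has \<open>\<gamma> \<le> 1\<close>. For \<open>\<gamma> < x\<^sub>l\<close> the bound on the block of all \<open>m > l\<close> suffices. For
  \<open>\<gamma> \<ge> x\<^sub>l\<close> the permanent and \<open>G\<^sub>0\<close> are bounded by \<open>1\<close> each and the terms \<open>2 \<le> m \<le> l\<close> as a block. The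
  resulting quantity, divided by \<open>\<gamma>\<^sup>(\<^sup>l\<^sup>+\<^sup>1\<^sup>)\<^sup>/\<^sup>2\<close>, decreases in \<open>\<gamma>\<close> (\<open>head_ratio_antimono\<close>), while the factor
  from the tail increases; the equation for \<open>x\<^sub>l\<close> says that the two agree there, so their common value
  is an admissible constant.
\<close>

section \<open>Permanents of rectangular matrices\<close>

text \<open>
  The rows and the columns are arbitrary sets, so that deleting a row or a column leads to a
  permanent of the same kind and proofs can proceed by induction on either set.
\<close>
definition rperm :: "'i set \<Rightarrow> 'k set \<Rightarrow> ('i \<Rightarrow> 'k \<Rightarrow> 'a::comm_semiring_1) \<Rightarrow> 'a" where
  "rperm J S A = (\<Sum>f\<in>{f. f \<in> S \<rightarrow>\<^sub>E J \<and> inj_on f S}. \<Prod>k\<in>S. A (f k) k)"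

lemma rperm_cong:
  "(\<And>j k. j \<in> J \<Longrightarrow> k \<in> S \<Longrightarrow> A j k = B j k) \<Longrightarrow> rperm J S A = rperm J S B"
  unfolding rperm_def by (intro sum.cong prod.cong refl) (auto simp: PiE_def Pi_def)

lemma rperm_empty_cols [simp]: "rperm J {} A = 1"
proof -
  have "{f. f \<in> {} \<rightarrow>\<^sub>E J \<and> inj_on f {}} = {\<lambda>_. undefined}" by auto
  then show ?thesis by (simp add: rperm_def)
qed

lemma rperm_insert_col:
  assumes "finite J" "finite S" "k \<notin> S"
  shows "rperm J (insert k S) A = (\<Sum>y\<in>J. A y k * rperm (J - {y}) S A)"
proof -
  let ?I = "\<lambda>y. {g. g \<in> S \<rightarrow>\<^sub>E J - {y} \<and> inj_on g S}"
  have fin: "finite (?I y)" for y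
    using assms by (intro finite_subset[OF _ finite_PiE[of S "\<lambda>_. J - {y}"]]) auto
  have "rperm J (insert k S) A =
      (\<Sum>p\<in>Sigma J ?I. \<Prod>l\<in>insert k S. A (((\<lambda>(y, g). g(k := y)) p) l) l)"
  proof -
    have eq: "{f. f \<in> insert k S \<rightarrow>\<^sub>E J \<and> inj_on f (insert k S)} = (\<lambda>(y, g). g(k := y)) ` Sigma J ?I"
      unfolding extensional_funcset_extend_domain_inj_on_eq[OF assms(3)]
      by (rule arg_cong[where f = "image _"]) auto
    have "inj_on (\<lambda>(y, g). g(k := y)) (Sigma J ?I)"
      by (rule inj_on_subset[OF extensional_funcset_extend_domain_inj_onI[OF assms(3), of J]]) auto
    then show ?thesis
      unfolding rperm_def eq by (subst sum.reindex) (simp_all add: o_def)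
  qed
  also have "\<dots> = (\<Sum>y\<in>J. \<Sum>g\<in>?I y. \<Prod>l\<in>insert k S. A ((g(k := y)) l) l)"
    by (subst sum.Sigma) (use assms fin in \<open>auto simp: split_def\<close>)
  also have "\<dots> = (\<Sum>y\<in>J. \<Sum>g\<in>?I y. A y k * (\<Prod>l\<in>S. A (g l) l))"
  proof (intro sum.cong refl)
    fix y g
    have "(\<Prod>l\<in>S. A ((g(k := y)) l) l) = (\<Prod>l\<in>S. A (g l) l)"
      using assms(3) by (intro prod.cong) auto
    then show "(\<Prod>l\<in>insert k S. A ((g(k := y)) l) l) = A y k * (\<Prod>l\<in>S. A (g l) l)"
      using assms by simp
  qed
  finally show ?thesis by (simp add: rperm_def sum_distrib_left)
qed

lemma rperm_eq_0:
  assumes "finite J" "finite S" "card J < card S"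
  shows "rperm J S A = 0"
proof -
  have empty: "{f. f \<in> S \<rightarrow>\<^sub>E J \<and> inj_on f S} = {}"
    using card_inj[of _ S J] assms by (auto simp: PiE_def not_less[symmetric])
  show ?thesis by (simp only: rperm_def empty sum.empty)
qed

lemma sum_Pow_insert:
  fixes g :: "'a set \<Rightarrow> 'b::comm_monoid_add"
  assumes "finite S" "k \<notin> S"
  shows "(\<Sum>T\<in>Pow (insert k S). g T) = (\<Sum>T\<in>Pow S. g T) + (\<Sum>T\<in>Pow S. g (insert k T))"
proof -
  have "inj_on (insert k) (Pow S)"
    using assms(2) by (auto simp: inj_on_def)
  then have "(\<Sum>T\<in>insert k ` Pow S. g T) = (\<Sum>T\<in>Pow S. g (insert k T))"
    by (simp add: sum.reindex)
  moreover have "(\<Sum>T\<in>Pow (insert k S). g T) = (\<Sum>T\<in>Pow S. g T) + (\<Sum>T\<in>insert k ` Pow S. g T)"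
    unfolding Pow_insert by (rule sum.union_disjoint) (use assms in auto)
  ultimately show ?thesis by simp
qed

text \<open>
  A row is either avoided or assigned to exactly one column. The induction on the columns expands
  along a column on both sides, which avoids taking injections apart by hand.
\<close>
lemma rperm_insert_row:
  assumes "finite S" "finite J" "j \<notin> J"
  shows "rperm (insert j J) S A = rperm J S A + (\<Sum>k\<in>S. A j k * rperm J (S - {k}) A)"
  using assms
proof (induction S arbitrary: J rule: finite_induct)
  case empty
  then show ?case by simp
next
  case (insert k S)
  have step: "rperm (insert j J - {y}) S A =
      rperm (J - {y}) S A + (\<Sum>l\<in>S. A j l * rperm (J - {y}) (S - {l}) A)" if "y \<in> J" for y
  proof -
    have "insert j J - {y} = insert j (J - {y})" using that insert.prems by auto
    then show ?thesis using insert.IH[of "J - {y}"] insert.prems by simp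
  qed
  have "rperm (insert j J) (insert k S) A =
      A j k * rperm J S A + (\<Sum>y\<in>J. A y k * rperm (insert j J - {y}) S A)"
    using insert by (simp add: rperm_insert_col)
  also have "(\<Sum>y\<in>J. A y k * rperm (insert j J - {y}) S A) =
      (\<Sum>y\<in>J. A y k * rperm (J - {y}) S A) +
      (\<Sum>l\<in>S. A j l * (\<Sum>y\<in>J. A y k * rperm (J - {y}) (S - {l}) A))"
    by (simp add: step algebra_simps sum.distrib sum_distrib_left sum.swap[of _ S J])
  also have "(\<Sum>l\<in>S. A j l * (\<Sum>y\<in>J. A y k * rperm (J - {y}) (S - {l}) A)) =
      (\<Sum>l\<in>S. A j l * rperm J (insert k S - {l}) A)"
  proof (intro sum.cong refl)
    fix l assume "l \<in> S"
    then have "insert k S - {l} = insert k (S - {l})" using insert by auto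
    then show "A j l * (\<Sum>y\<in>J. A y k * rperm (J - {y}) (S - {l}) A) =
        A j l * rperm J (insert k S - {l}) A"
      using insert by (simp add: rperm_insert_col)
  qed
  finally show ?case using insert by (simp add: rperm_insert_col algebra_simps)
qed

text \<open>
  An injection from \<open>S\<close> into \<open>J\<close> misses exactly \<open>card J - card S\<close> rows.
\<close>
lemma sum_rperm_delete_row:
  fixes A :: "'i \<Rightarrow> 'k \<Rightarrow> 'a::comm_ring_1"
  assumes "finite S" "finite J" "card S \<le> card J"
  shows "(\<Sum>y\<in>J. rperm (J - {y}) S A) = of_nat (card J - card S) * rperm J S A"
  using assms
proof (induction S arbitrary: J rule: finite_induct)
  case empty
  then show ?case by simp
next
  case (insert k S)
  have "(\<Sum>y\<in>J. rperm (J - {y}) (insert k S) A) =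
      (\<Sum>y\<in>J. \<Sum>z\<in>J - {y}. A z k * rperm (J - {y} - {z}) S A)"
    using insert by (simp add: rperm_insert_col)
  also have "\<dots> = (\<Sum>z\<in>J. \<Sum>y\<in>J - {z}. A z k * rperm (J - {z} - {y}) S A)"
  proof -
    have "(\<Sum>y\<in>J. \<Sum>z\<in>{z \<in> J. z \<noteq> y}. A z k * rperm (J - {y} - {z}) S A) =
        (\<Sum>z\<in>J. \<Sum>y\<in>{y \<in> J. z \<noteq> y}. A z k * rperm (J - {y} - {z}) S A)"
      by (rule sum.swap_restrict) (use insert in auto)
    moreover have "{z \<in> J. z \<noteq> y} = J - {y}" "{y \<in> J. z \<noteq> y} = J - {z}" for y z by auto
    moreover have "J - {y} - {z} = J - {z} - {y}" for y z by auto
    ultimately show ?thesis by simp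
  qed
  also have "\<dots> = (\<Sum>z\<in>J. A z k * (of_nat (card J - card (insert k S)) * rperm (J - {z}) S A))"
  proof (intro sum.cong refl)
    fix z assume "z \<in> J"
    then show "(\<Sum>y\<in>J - {z}. A z k * rperm (J - {z} - {y}) S A) =
        A z k * (of_nat (card J - card (insert k S)) * rperm (J - {z}) S A)"
      using insert.IH[of "J - {z}"] insert.prems insert.hyps
      by (simp add: sum_distrib_left[symmetric])
  qed
  finally show ?case
    using insert by (simp add: rperm_insert_col sum_distrib_left algebra_simps)
qed

text \<open>
  Multilinearity: in each column one chooses either \<open>A\<close> or the constant \<open>c\<close>. For a column where
  \<open>c\<close> is chosen any row left over is as good as any other, so each partial injection on \<open>T\<close> is
  counted once per extension to \<open>S\<close>; the quotient of factorials is the number of extensions.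
\<close>
lemma rperm_shift_columns:
  fixes A :: "'i \<Rightarrow> 'k \<Rightarrow> 'a::field_char_0"
  assumes "finite S" "finite J" "card S \<le> card J"
  shows "rperm J S (\<lambda>j k. A j k + c k) =
    (\<Sum>T\<in>Pow S. fact (card J - card T) / fact (card J - card S) * rperm J T A * (\<Prod>k\<in>S - T. c k))"
  using assms
proof (induction S arbitrary: J rule: finite_induct)
  case empty
  then show ?case by simp
next
  case (insert k S)
  let ?N = "card J"
  let ?q = "\<lambda>T. (fact (?N - Suc (card T)) :: 'a) / fact (?N - Suc (card S))"
  let ?p = "\<lambda>T. \<Prod>l\<in>S - T. c l"
  have IH: "rperm (J - {y}) S (\<lambda>j k. A j k + c k) =
      (\<Sum>T\<in>Pow S. ?q T * rperm (J - {y}) T A * ?p T)" if "y \<in> J" for y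
    using insert.IH[of "J - {y}"] insert.prems insert.hyps that by simp
  have "rperm J (insert k S) (\<lambda>j k. A j k + c k) =
      (\<Sum>y\<in>J. (A y k + c k) * (\<Sum>T\<in>Pow S. ?q T * rperm (J - {y}) T A * ?p T))"
    using insert IH by (simp add: rperm_insert_col)
  also have "\<dots> = (\<Sum>T\<in>Pow S. ?q T * ?p T * (\<Sum>y\<in>J. A y k * rperm (J - {y}) T A)) +
      (\<Sum>T\<in>Pow S. ?q T * (c k * ?p T) * (\<Sum>y\<in>J. rperm (J - {y}) T A))"
    by (simp add: sum_distrib_left sum_distrib_right sum.distrib algebra_simps add_divide_distrib sum_divide_distrib
        sum.swap[of _ "Pow S" J])
  also have "(\<Sum>T\<in>Pow S. ?q T * ?p T * (\<Sum>y\<in>J. A y k * rperm (J - {y}) T A)) =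
      (\<Sum>T\<in>Pow S. fact (?N - card (insert k T)) / fact (?N - card (insert k S)) *
         rperm J (insert k T) A * (\<Prod>l\<in>insert k S - insert k T. c l))"
  proof (intro sum.cong refl)
    fix T assume T: "T \<in> Pow S"
    then have "k \<notin> T" "finite T" "insert k S - insert k T = S - T"
      using insert.hyps finite_subset by auto
    then show "?q T * ?p T * (\<Sum>y\<in>J. A y k * rperm (J - {y}) T A) =
        fact (?N - card (insert k T)) / fact (?N - card (insert k S)) *
         rperm J (insert k T) A * (\<Prod>l\<in>insert k S - insert k T. c l)"
      using insert.hyps insert.prems by (simp add: rperm_insert_col)
  qed
  also have "(\<Sum>T\<in>Pow S. ?q T * (c k * ?p T) * (\<Sum>y\<in>J. rperm (J - {y}) T A)) =
      (\<Sum>T\<in>Pow S. fact (?N - card T) / fact (?N - card (insert k S)) *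
         rperm J T A * (\<Prod>l\<in>insert k S - T. c l))"
  proof (intro sum.cong refl)
    fix T assume T: "T \<in> Pow S"
    then have *: "finite T" "insert k S - T = insert k (S - T)" "k \<notin> S - T"
      using insert.hyps finite_subset by auto
    have le: "card T \<le> card S" using T insert.hyps by (simp add: card_mono)
    then have lt: "card T < ?N" using insert.prems insert.hyps by simp
    have "(fact (?N - card T) :: 'a) = of_nat (?N - card T) * fact (?N - Suc (card T))"
      using lt by (metis Suc_diff_Suc fact_Suc)
    then show "?q T * (c k * ?p T) * (\<Sum>y\<in>J. rperm (J - {y}) T A) =
        fact (?N - card T) / fact (?N - card (insert k S)) *
         rperm J T A * (\<Prod>l\<in>insert k S - T. c l)"
      using * lt insert.hyps insert.prems by (simp add: sum_rperm_delete_row)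
  qed
  finally show ?case
    unfolding sum_Pow_insert[OF insert.hyps(1,2)] by (subst add.commute)
qed

lemma norm_rperm_le:
  fixes A :: "'i \<Rightarrow> 'k \<Rightarrow> complex"
  assumes "finite S" "finite J" "card S \<le> card J"
    and "\<And>j k. j \<in> J \<Longrightarrow> k \<in> S \<Longrightarrow> norm (A j k) \<le> 1"
  shows "norm (rperm J S A) \<le> fact (card J) / fact (card J - card S)"
  using assms
proof (induction S arbitrary: J rule: finite_induct)
  case empty
  then show ?case by simp
next
  case (insert k S)
  have "norm (rperm J (insert k S) A) \<le> (\<Sum>y\<in>J. norm (A y k) * norm (rperm (J - {y}) S A))"
    using insert by (simp add: rperm_insert_col norm_mult[symmetric] norm_sum)
  also have "\<dots> \<le> (\<Sum>y\<in>J. 1 * (fact (card J - 1) / fact (card J - 1 - card S)))"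
  proof (intro sum_mono mult_mono)
    fix y assume "y \<in> J"
    then show "norm (rperm (J - {y}) S A) \<le> fact (card J - 1) / fact (card J - 1 - card S)"
      using insert.IH[of "J - {y}"] insert.prems insert.hyps by simp
  qed (use insert in auto)
  also have "\<dots> = fact (card J) / fact (card J - card (insert k S))"
    using insert by (cases "card J") auto
  finally show ?case .
qed

section \<open>Coefficients of products of linear forms\<close>

definition squarefree_monom :: "nat set \<Rightarrow> nat \<Rightarrow>\<^sub>0 nat" where
  "squarefree_monom S = (\<Sum>k\<in>S. Poly_Mapping.single k 1)"

lemma lookup_squarefree_monom:
  "finite S \<Longrightarrow> Poly_Mapping.lookup (squarefree_monom S) k = (if k \<in> S then 1 else 0)"
  unfolding squarefree_monom_def
  by (induction S rule: finite_induct) (auto simp: lookup_add lookup_single when_def)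

lemma lookup_mult_single:
  fixes p :: mpoly
  shows "Poly_Mapping.lookup (p * Poly_Mapping.single d c) M = (\<Sum>l. Poly_Mapping.lookup p l * c when M = l + d)"
proof -
  have "(\<Sum>q. Poly_Mapping.lookup (Poly_Mapping.single d c) q when M = l + q) = (c when M = l + d)" for l
  proof -
    have "(\<Sum>q. Poly_Mapping.lookup (Poly_Mapping.single d c) q when M = l + q)
        = (\<Sum>q. (c when M = l + d) when q = d)"
      by (intro Sum_any.cong) (auto simp: lookup_single when_def)
    then show ?thesis by simp
  qed
  then show ?thesis by (simp add: lookup_mult mult_when)
qed

text \<open>
  Exponent vectors cancel, hence multiplication by one variable shifts coefficients, and the only
  monomial that the variable \<open>x\<^sub>k\<close> sends to a squarefree one containing \<open>x\<^sub>k\<close> is the one with \<open>x\<^sub>k\<close> removed.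
\<close>
lemma lookup_mult_var:
  fixes p :: mpoly
  assumes "finite S"
  shows "Poly_Mapping.lookup (p * Poly_Mapping.single (Poly_Mapping.single k 1) c) (squarefree_monom S)
    = (if k \<in> S then c * Poly_Mapping.lookup p (squarefree_monom (S - {k})) else 0)"
proof (cases "k \<in> S")
  case True
  then have "squarefree_monom S = squarefree_monom (S - {k}) + Poly_Mapping.single k 1"
    using assms by (simp add: squarefree_monom_def sum.remove add.commute)
  then have "(\<Sum>l. Poly_Mapping.lookup p l * c when squarefree_monom S = l + Poly_Mapping.single k 1)
      = (\<Sum>l. Poly_Mapping.lookup p l * c when l = squarefree_monom (S - {k}))"
    by (intro Sum_any.cong) (auto simp: when_def)
  then show ?thesis using True by (simp add: lookup_mult_single mult.commute)
next
  case False
  have "squarefree_monom S \<noteq> l + Poly_Mapping.single k 1" for l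
  proof
    assume "squarefree_monom S = l + Poly_Mapping.single k 1"
    then have "Poly_Mapping.lookup (squarefree_monom S) k = Poly_Mapping.lookup l k + 1"
      by (simp add: lookup_add)
    then show False using False assms by (simp add: lookup_squarefree_monom)
  qed
  then show ?thesis using False by (simp add: lookup_mult_single)
qed

text \<open>
  Squarefree coefficients of a product with a linear form involve only squarefree coefficients
  of the other factor. This closure property is what makes the following two inductions possible.
\<close>
lemma lookup_mult_linear_form:
  assumes "S \<subseteq> {1..n}"
  shows "Poly_Mapping.lookup (p * linear_form n c) (squarefree_monom S)
    = (\<Sum>k\<in>S. c k * Poly_Mapping.lookup p (squarefree_monom (S - {k})))"
proof -
  have fin: "finite S" using assms finite_subset by blast
  have "Poly_Mapping.lookup (p * linear_form n c) (squarefree_monom S)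
      = (\<Sum>k\<in>{1..n}. if k \<in> S then c k * Poly_Mapping.lookup p (squarefree_monom (S - {k})) else 0)"
    by (simp add: linear_form_def sum_distrib_left lookup_sum lookup_mult_var[OF fin, simplified])
  also have "\<dots> = (\<Sum>k\<in>{1..n} \<inter> S. c k * Poly_Mapping.lookup p (squarefree_monom (S - {k})))"
    by (simp add: sum.inter_restrict)
  also have "{1..n} \<inter> S = S" using assms by auto
  finally show ?thesis .
qed

lemma lookup_one_squarefree_monom:
  assumes "finite S"
  shows "Poly_Mapping.lookup (1 :: mpoly) (squarefree_monom S) = (if S = {} then 1 else 0)"
proof (cases "S = {}")
  case True
  then show ?thesis by (simp add: squarefree_monom_def)
next
  case False
  then obtain k where "k \<in> S" by blast
  then have "Poly_Mapping.lookup (squarefree_monom S) k \<noteq> Poly_Mapping.lookup 0 k"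
    using assms by (simp add: lookup_squarefree_monom)
  then have "squarefree_monom S \<noteq> 0" by metis
  then show ?thesis using False by (simp add: lookup_one)
qed

lemma lookup_prod_one_plus_linear_form:
  assumes "finite J" "S \<subseteq> {1..n}"
  shows "Poly_Mapping.lookup (\<Prod>j\<in>J. 1 + linear_form n (A j)) (squarefree_monom S) = rperm J S A"
  using assms
proof (induction J arbitrary: S rule: finite_induct)
  case empty
  have "finite S" using empty finite_subset by blast
  then show ?case
    by (cases "S = {}") (simp_all add: lookup_one_squarefree_monom rperm_eq_0 card_gt_0_iff)
next
  case (insert j J)
  have fin: "finite S" using insert.prems finite_subset by blast
  have "Poly_Mapping.lookup (\<Prod>j\<in>insert j J. 1 + linear_form n (A j)) (squarefree_monom S)
      = Poly_Mapping.lookup ((\<Prod>j\<in>J. 1 + linear_form n (A j)) + (\<Prod>j\<in>J. 1 + linear_form n (A j)) * linear_form n (A j))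
         (squarefree_monom S)"
    using insert.hyps by (simp add: algebra_simps)
  also have "\<dots> = rperm J S A + (\<Sum>k\<in>S. A j k * rperm J (S - {k}) A)"
    unfolding lookup_add lookup_mult_linear_form[OF insert.prems]
    using insert.IH[OF insert.prems] insert.IH[OF subset_trans[OF Diff_subset insert.prems]] by simp
  finally show ?case unfolding rperm_insert_row[OF fin insert.hyps] .
qed

text \<open>
  The factor \<open>fact r\<close> is the number of orders in which the \<open>r\<close> factors can supply the variables
  outside \<open>T\<close>.
\<close>
lemma lookup_mult_linear_form_power:
  assumes "S \<subseteq> {1..n}"
  shows "Poly_Mapping.lookup (p * linear_form n c ^ r) (squarefree_monom S)
    = fact r * (\<Sum>T\<in>{T \<in> Pow S. card (S - T) = r}. Poly_Mapping.lookup p (squarefree_monom T) * (\<Prod>k\<in>S - T. c k))"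
  using assms
proof (induction r arbitrary: S)
  case 0
  have "finite S" using 0 finite_subset by blast
  then have "{T \<in> Pow S. card (S - T) = 0} = {S}" by auto
  then show ?case by simp
next
  case (Suc r)
  let ?q = "\<lambda>T. Poly_Mapping.lookup p (squarefree_monom T)"
  have fin: "finite S" using Suc finite_subset by blast
  have "Poly_Mapping.lookup (p * linear_form n c ^ Suc r) (squarefree_monom S)
      = Poly_Mapping.lookup (p * linear_form n c ^ r * linear_form n c) (squarefree_monom S)"
    by (simp add: mult_ac)
  also have "\<dots> = (\<Sum>k\<in>S. c k * (fact r *
      (\<Sum>T\<in>{T \<in> Pow (S - {k}). card (S - {k} - T) = r}. ?q T * (\<Prod>l\<in>S - {k} - T. c l))))"
    unfolding lookup_mult_linear_form[OF Suc.prems]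
  proof (intro sum.cong refl)
    fix k
    have "S - {k} \<subseteq> {1..n}" using Suc.prems by auto
    then show "c k * Poly_Mapping.lookup (p * linear_form n c ^ r) (squarefree_monom (S - {k})) = c k * (fact r *
      (\<Sum>T\<in>{T \<in> Pow (S - {k}). card (S - {k} - T) = r}. ?q T * (\<Prod>l\<in>S - {k} - T. c l)))"
      by (simp add: Suc.IH)
  qed
  also have "\<dots> = fact r * (\<Sum>k\<in>S. \<Sum>T\<in>{T \<in> Pow S. k \<in> S - T \<and> card (S - T) = Suc r}.
      ?q T * (\<Prod>l\<in>S - T. c l))"
  proof -
    have "c k * (fact r *
      (\<Sum>T\<in>{T \<in> Pow (S - {k}). card (S - {k} - T) = r}. ?q T * (\<Prod>l\<in>S - {k} - T. c l)))
      = fact r * (\<Sum>T\<in>{T \<in> Pow S. k \<in> S - T \<and> card (S - T) = Suc r}. ?q T * (\<Prod>l\<in>S - T. c l))"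
      if k: "k \<in> S" for k
    proof -
      have eq: "S - T = insert k (S - {k} - T)" if "T \<subseteq> S - {k}" for T using k that by auto
      have card_eq: "card (S - T) = Suc (card (S - {k} - T))" if "T \<subseteq> S - {k}" for T
        using fin by (subst eq[OF that]) simp
      have prod_eq: "(\<Prod>l\<in>S - T. c l) = c k * (\<Prod>l\<in>S - {k} - T. c l)" if "T \<subseteq> S - {k}" for T
        using fin by (subst eq[OF that]) simp
      have "{T \<in> Pow S. k \<in> S - T \<and> card (S - T) = Suc r} = {T \<in> Pow (S - {k}). card (S - {k} - T) = r}"
      proof (intro set_eqI iffI)
        fix T assume "T \<in> {T \<in> Pow S. k \<in> S - T \<and> card (S - T) = Suc r}"
        then show "T \<in> {T \<in> Pow (S - {k}). card (S - {k} - T) = r}"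
          using card_eq[of T] by auto
      next
        fix T assume "T \<in> {T \<in> Pow (S - {k}). card (S - {k} - T) = r}"
        then show "T \<in> {T \<in> Pow S. k \<in> S - T \<and> card (S - T) = Suc r}"
          using card_eq[of T] k by auto
      qed
      then show ?thesis
        by (simp add: sum_distrib_left prod_eq mult_ac)
    qed
    then show ?thesis by (simp add: sum_distrib_left)
  qed
  also have "(\<Sum>k\<in>S. \<Sum>T\<in>{T \<in> Pow S. k \<in> S - T \<and> card (S - T) = Suc r}. ?q T * (\<Prod>l\<in>S - T. c l))
      = (\<Sum>T\<in>{T \<in> Pow S. card (S - T) = Suc r}. \<Sum>k\<in>S - T. ?q T * (\<Prod>l\<in>S - T. c l))"
  proof -
    let ?P = "{T \<in> Pow S. card (S - T) = Suc r}"
    have swap: "(\<Sum>k\<in>S. \<Sum>T\<in>{T \<in> ?P. k \<in> S - T}. ?q T * (\<Prod>l\<in>S - T. c l))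
        = (\<Sum>T\<in>?P. \<Sum>k\<in>{k \<in> S. k \<in> S - T}. ?q T * (\<Prod>l\<in>S - T. c l))"
      by (rule sum.swap_restrict) (use fin in auto)
    have sets: "{T \<in> Pow S. k \<in> S - T \<and> card (S - T) = Suc r} = {T \<in> ?P. k \<in> S - T}" for k
      by auto
    have elems: "{k \<in> S. k \<in> S - T} = S - T" for T by auto
    show ?thesis using swap unfolding sets elems .
  qed
  also have "\<dots> = of_nat (Suc r) * (\<Sum>T\<in>{T \<in> Pow S. card (S - T) = Suc r}. ?q T * (\<Prod>l\<in>S - T. c l))"
    by (simp add: sum_distrib_left)
  finally show ?case by (simp add: mult_ac)
qed

lemma G_eq:
  assumes "m \<le> n"
  shows "G N n Z m = fact (N - m) / fact N *
    (\<Sum>S\<in>{S \<in> Pow {1..n}. card S = m}. rperm {1..N} S (acoef N Z) * (\<Prod>k\<in>{1..n} - S. zbar N Z k))"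
proof -
  have "{T \<in> Pow {1..n}. card ({1..n} - T) = n - m} = {S \<in> Pow {1..n}. card S = m}"
  proof -
    have "card ({1..n} - T) = n - m \<longleftrightarrow> card T = m" if "T \<in> Pow {1..n}" for T
    proof -
      have "card ({1..n} - T) = n - card T" "card T \<le> n"
        using that card_Diff_subset[of T "{1..n}"] card_mono[of "{1..n}" T] finite_subset[of T "{1..n}"]
        by auto
      then show ?thesis using assms by auto
    qed
    then show ?thesis by (intro Collect_cong conj_cong refl)
  qed
  then have "coeff_all n ((\<Prod>j\<in>{1..N}. 1 + U N n Z j) * linear_form n (zbar N Z) ^ (n - m))
      = fact (n - m) * (\<Sum>S\<in>{S \<in> Pow {1..n}. card S = m}.
          Poly_Mapping.lookup (\<Prod>j\<in>{1..N}. 1 + U N n Z j) (squarefree_monom S) * (\<Prod>k\<in>{1..n} - S. zbar N Z k))"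
    unfolding coeff_all_def squarefree_monom_def[symmetric]
    by (simp add: lookup_mult_linear_form_power)
  also have "\<dots> = fact (n - m) * (\<Sum>S\<in>{S \<in> Pow {1..n}. card S = m}.
          rperm {1..N} S (acoef N Z) * (\<Prod>k\<in>{1..n} - S. zbar N Z k))"
    by (auto simp: U_def lookup_prod_one_plus_linear_form)
  finally show ?thesis by (simp add: G_def)
qed

lemma sum_subsets_by_card:
  fixes g :: "'a set \<Rightarrow> 'b::comm_monoid_add"
  assumes "finite S"
  shows "(\<Sum>T\<in>Pow S. g T) = (\<Sum>m\<le>card S. \<Sum>T\<in>{T \<in> Pow S. card T = m}. g T)"
  by (rule sum.group[symmetric]) (use assms in \<open>auto simp: card_mono\<close>)

text \<open>
  This is the expansion of the permanent of the matrix with entries \<open>acoef N Z j k + zbar N Z k\<close>,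
  grouped by the number of columns in which the centered entry is chosen.
\<close>
lemma Per_eq_sum_G:
  assumes "n \<le> N"
  shows "fact (N - n) / fact N * Per N n Z = (\<Sum>m\<le>n. G N n Z m)"
proof -
  have "Per N n Z = rperm {1..N} {1..n} (\<lambda>j k. acoef N Z j k + zbar N Z k)"
    by (simp add: Per_def rperm_def acoef_def)
  also have "\<dots> = (\<Sum>T\<in>Pow {1..n}. fact (N - card T) / fact (N - n) * rperm {1..N} T (acoef N Z) *
      (\<Prod>k\<in>{1..n} - T. zbar N Z k))"
    using assms rperm_shift_columns[of "{1..n}" "{1..N}" "acoef N Z" "zbar N Z"] by simp
  also have "\<dots> = (\<Sum>m\<le>n. \<Sum>T\<in>{T \<in> Pow {1..n}. card T = m}.
      fact (N - card T) / fact (N - n) * rperm {1..N} T (acoef N Z) * (\<Prod>k\<in>{1..n} - T. zbar N Z k))"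
    unfolding sum_subsets_by_card[OF finite_atLeastAtMost] by simp
  finally show ?thesis
    by (simp add: G_eq sum_distrib_left mult.assoc)
qed

section \<open>Elementary symmetric polynomials\<close>

definition esym :: "'i set \<Rightarrow> nat \<Rightarrow> ('i \<Rightarrow> 'a::comm_semiring_1) \<Rightarrow> 'a" where
  "esym J m u = (\<Sum>T\<in>{T \<in> Pow J. card T = m}. \<Prod>j\<in>T. u j)"

lemma esym_0: "finite J \<Longrightarrow> esym J 0 u = 1"
proof -
  assume "finite J"
  then have "{T \<in> Pow J. card T = 0} = {{}}" by (auto dest: finite_subset)
  then show ?thesis by (simp add: esym_def)
qed

lemma esym_empty_Suc: "esym {} (Suc m) u = 0"
proof -
  have none: "{T \<in> Pow {}. card T = Suc m} = {}" by auto
  show ?thesis by (simp only: esym_def none sum.empty)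
qed

lemma esym_card: "finite J \<Longrightarrow> esym J (card J) u = (\<Prod>j\<in>J. u j)"
proof -
  assume "finite J"
  then have "{T \<in> Pow J. card T = card J} = {J}" by (auto dest: card_subset_eq)
  then show ?thesis by (simp add: esym_def)
qed

lemma esym_insert:
  assumes "finite J" "j \<notin> J"
  shows "esym (insert j J) (Suc m) u = esym J (Suc m) u + u j * esym J m u"
proof -
  have fin: "finite T" if "T \<in> Pow J" for T using assms that finite_subset by auto
  have "esym (insert j J) (Suc m) u =
      (\<Sum>T\<in>Pow (insert j J). if card T = Suc m then \<Prod>i\<in>T. u i else 0)"
    using assms unfolding esym_def by (intro sum.inter_filter) auto
  also have "\<dots> = (\<Sum>T\<in>Pow J. if card T = Suc m then \<Prod>i\<in>T. u i else 0) +
      (\<Sum>T\<in>Pow J. if card T = m then u j * (\<Prod>i\<in>T. u i) else 0)"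
    unfolding sum_Pow_insert[OF assms]
    by (intro arg_cong2[where f = "(+)"] sum.cong refl) (use fin assms in \<open>auto simp: card_insert_if\<close>)
  also have "\<dots> = esym J (Suc m) u + u j * esym J m u"
    unfolding esym_def sum_distrib_left by (subst (1 2) sum.inter_filter) (use assms in auto)
  finally show ?thesis .
qed

text \<open>
  On the diagonal the permanent is an elementary symmetric polynomial, since the recursion along
  rows becomes the recursion for \<open>esym\<close>.
\<close>
lemma rperm_equal_columns:
  assumes "finite J" "finite S"
  shows "rperm J S (\<lambda>j k. u j) = fact (card S) * esym J (card S) u"
  using assms
proof (induction J arbitrary: S rule: finite_induct)
  case empty
  show ?case
  proof (cases "card S")
    case 0
    then show ?thesis using empty by (simp add: esym_0)
  next
    case (Suc s)
    then show ?thesis using empty by (simp add: esym_empty_Suc rperm_eq_0)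
  qed
next
  case (insert j J)
  show ?case
  proof (cases "card S")
    case 0
    then show ?thesis using insert by (simp add: esym_0)
  next
    case (Suc s)
    then show ?thesis
      using insert
      by (simp add: rperm_insert_row esym_insert algebra_simps del: fact_Suc)
        (simp add: algebra_simps)
  qed
qed

text \<open>
  The homogeneous form, with \<open>w\<close> in place of \<open>1\<close>, is kept because the case \<open>w = 0\<close> isolates the
  top coefficient; the estimate below needs that case when \<open>m\<close> is the number of variables.
\<close>
lemma prod_add_scaled:
  fixes u :: "'i \<Rightarrow> 'a::comm_semiring_1"
  assumes "finite J"
  shows "(\<Prod>j\<in>J. w + z * u j) = (\<Sum>m\<le>card J. esym J m u * w ^ (card J - m) * z ^ m)"
proof -
  have "(\<Prod>j\<in>J. w + z * u j) = (\<Sum>T\<in>Pow J. (\<Prod>j\<in>T. z * u j) * (\<Prod>j\<in>J - T. w))"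
    using prod_add[OF assms, of "\<lambda>j. z * u j" "\<lambda>_. w"] by (simp add: add.commute)
  also have "\<dots> = (\<Sum>T\<in>Pow J. (\<Prod>j\<in>T. u j) * w ^ (card J - card T) * z ^ card T)"
  proof (intro sum.cong refl)
    fix T assume "T \<in> Pow J"
    then show "(\<Prod>j\<in>T. z * u j) * (\<Prod>j\<in>J - T. w) = (\<Prod>j\<in>T. u j) * w ^ (card J - card T) * z ^ card T"
      using assms by (simp add: prod.distrib card_Diff_subset finite_subset mult_ac)
  qed
  finally show ?thesis
    by (simp add: sum_subsets_by_card[OF assms] esym_def sum_distrib_right)
qed

text \<open>
  Convexity of powers: the left side is the tangent at \<open>x\<close>.
\<close>
lemma power_ge_tangent:
  fixes x y :: real
  assumes "x \<ge> 0" "y \<ge> 0"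
  shows "x ^ Suc p + real (Suc p) * x ^ p * (y - x) \<le> y ^ Suc p"
proof (induction p)
  case 0
  then show ?case by simp
next
  case (Suc p)
  have "y * (x ^ Suc p + real (Suc p) * x ^ p * (y - x)) \<le> y * y ^ Suc p"
    using Suc assms(2) by (rule mult_left_mono)
  moreover have "y * (x ^ Suc p + real (Suc p) * x ^ p * (y - x)) =
      x ^ Suc (Suc p) + real (Suc (Suc p)) * x ^ Suc p * (y - x) + real (Suc p) * (x ^ p * (y - x)\<^sup>2)"
    by (simp add: algebra_simps power2_eq_square)
  moreover have "real (Suc p) * (x ^ p * (y - x)\<^sup>2) \<ge> 0" using assms by simp
  ultimately show ?case by simp
qed

text \<open>
  Maclaurin's inequality. Adding a variable moves the mean from \<open>\<mu>\<close> to \<open>\<nu>\<close>. By the induction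
  hypothesis the left side is at most an affine function of the new variable, and that function is
  a multiple of the tangent of \<open>x \<mapsto> x\<^sup>m\<close> at \<open>\<mu>\<close>, evaluated at \<open>\<nu>\<close>.
\<close>
lemma maclaurin_esym:
  fixes u :: "'i \<Rightarrow> real"
  assumes "finite J" "\<And>j. j \<in> J \<Longrightarrow> u j \<ge> 0"
  shows "esym J m u \<le> real (card J choose m) * ((\<Sum>j\<in>J. u j) / real (card J)) ^ m"
  using assms
proof (induction J arbitrary: m rule: finite_induct)
  case empty
  then show ?case by (cases m) (simp_all add: esym_0 esym_empty_Suc)
next
  case (insert j J)
  show ?case
  proof (cases m)
    case 0
    then show ?thesis using insert by (simp add: esym_0)
  next
    case (Suc p)
    define N where "N = card J"
    define \<mu> where "\<mu> = (\<Sum>j\<in>J. u j) / real N"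
    define \<nu> where "\<nu> = (\<Sum>j\<in>insert j J. u j) / real (Suc N)"
    have N: "card (insert j J) = Suc N" using insert by (simp add: N_def)
    have sum_J: "(\<Sum>j\<in>J. u j) = real N * \<mu>"
      using insert by (cases "N = 0") (auto simp: \<mu>_def N_def)
    have \<mu>: "\<mu> \<ge> 0" using insert.prems unfolding \<mu>_def by (intro divide_nonneg_nonneg sum_nonneg) auto
    have \<nu>: "\<nu> \<ge> 0" using insert.prems unfolding \<nu>_def by (intro divide_nonneg_nonneg sum_nonneg) auto
    have diff: "real (Suc N) * (\<nu> - \<mu>) = u j - \<mu>"
      using insert.hyps sum_J by (simp add: \<nu>_def field_simps)
    have binom: "real (Suc N choose Suc p) * real (Suc p) = real (Suc N) * real (N choose p)"
      by (metis Suc_times_binomial mult.commute of_nat_mult)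
    have "esym (insert j J) (Suc p) u = esym J (Suc p) u + u j * esym J p u"
      using insert.hyps by (rule esym_insert)
    also have "\<dots> \<le> real (N choose Suc p) * \<mu> ^ Suc p + u j * (real (N choose p) * \<mu> ^ p)"
      using insert.IH[of "Suc p"] insert.IH[of p] insert.prems
      by (intro add_mono mult_left_mono) (auto simp: N_def \<mu>_def)
    also have "\<dots> = real (Suc N choose Suc p) * \<mu> ^ Suc p + real (N choose p) * \<mu> ^ p * (u j - \<mu>)"
      by (simp add: algebra_simps)
    also have "\<dots> = real (Suc N choose Suc p) * \<mu> ^ Suc p +
        real (Suc N) * real (N choose p) * (\<mu> ^ p * (\<nu> - \<mu>))"
      by (simp add: diff[symmetric] mult_ac)
    also have "\<dots> = real (Suc N choose Suc p) * (\<mu> ^ Suc p + real (Suc p) * \<mu> ^ p * (\<nu> - \<mu>))"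
      by (simp only: binom[symmetric] distrib_left mult_ac)
    also have "\<dots> \<le> real (Suc N choose Suc p) * \<nu> ^ Suc p"
      using power_ge_tangent[OF \<mu> \<nu>] by (intro mult_left_mono) auto
    finally show ?thesis unfolding Suc N \<nu>_def .
  qed
qed

lemma prod_le_mean_power:
  fixes u :: "'i \<Rightarrow> real"
  assumes "finite J" "\<And>j. j \<in> J \<Longrightarrow> u j \<ge> 0"
  shows "(\<Prod>j\<in>J. u j) \<le> ((\<Sum>j\<in>J. u j) / real (card J)) ^ card J"
  using maclaurin_esym[OF assms, where m = "card J"] by (simp add: esym_card[OF assms(1)])

lemma coeff_higher_pderiv_0:
  "coeff ((pderiv ^^ m) p) i * fact i = fact (m + i) * coeff p (m + i)" for p :: "complex poly"
proof (induction m arbitrary: i)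
  case 0
  then show ?case by simp
next
  case (Suc m)
  have "coeff ((pderiv ^^ Suc m) p) i * fact i = coeff ((pderiv ^^ m) p) (Suc i) * fact (Suc i)"
    by (simp add: coeff_pderiv)
  also have "\<dots> = fact (m + Suc i) * coeff p (m + Suc i)" by (rule Suc)
  finally show ?case by simp
qed

lemma higher_deriv_poly: "(deriv ^^ m) (poly p) = poly ((pderiv ^^ m) p)" for p :: "complex poly"
proof (induction m)
  case (Suc m)
  have "deriv (poly q) = poly (pderiv q)" for q :: "complex poly"
    by (intro ext DERIV_imp_deriv poly_DERIV)
  then show ?case using Suc by simp
qed simp

text \<open>
  Cauchy's inequality for the derivatives at the center of a disc, read as a bound on coefficients.
\<close>
lemma cauchy_coeff_bound:
  fixes p :: "complex poly"
  assumes "r > 0" "\<And>z. norm z = r \<Longrightarrow> norm (poly p z) \<le> B"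
  shows "norm (coeff p m) * r ^ m \<le> B"
proof -
  have "norm ((deriv ^^ m) (poly p) 0) \<le> fact m * B / r ^ m"
    by (rule Cauchy_inequality) (use assms in \<open>auto intro!: holomorphic_intros continuous_intros\<close>)
  moreover have "(deriv ^^ m) (poly p) 0 = fact m * coeff p m"
    using coeff_higher_pderiv_0[of m p 0] by (simp add: higher_deriv_poly poly_0_coeff_0)
  ultimately show ?thesis using assms(1) by (simp add: norm_mult field_simps)
qed

text \<open>
  The polynomial \<open>\<Prod>\<^sub>j (w + z u\<^sub>j)\<close> has the coefficient \<open>e\<^sub>m(u) w\<^sup>N\<^sup>-\<^sup>m\<close> at \<open>z\<^sup>m\<close>. On \<open>|z| = r\<close> the mean of
  \<open>|w + z u\<^sub>j|\<^sup>2\<close> is \<open>w\<^sup>2 + r\<^sup>2 s / N\<close> with \<open>s = \<Sum>\<^sub>j |u\<^sub>j|\<^sup>2\<close>, as the mixed terms cancel. The choice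
  \<open>w\<^sup>2 = (N - m) / N\<close> and \<open>r\<^sup>2 = m / s\<close> makes this mean \<open>1\<close>, so the product is at most \<open>1\<close> in modulus; it is
  the choice that minimizes the resulting bound. For \<open>m = N\<close> it gives \<open>w = 0\<close>, and the powers
  \<open>0\<^sup>0 = 1\<close> are then correct.
\<close>
lemma norm_esym_le:
  fixes u :: "'i \<Rightarrow> complex"
  assumes "finite J" "(\<Sum>j\<in>J. u j) = 0" "m \<ge> 1" "m \<le> card J"
  shows "(norm (esym J m u))\<^sup>2 * (real (card J - m) ^ (card J - m) * real m ^ m)
    \<le> real (card J) ^ (card J - m) * (\<Sum>j\<in>J. (norm (u j))\<^sup>2) ^ m"
proof -
  define N where "N = card J"
  define s where "s = (\<Sum>j\<in>J. (norm (u j))\<^sup>2)"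
  have N: "N > 0" using assms by (simp add: N_def)
  have "s \<ge> 0" unfolding s_def by (intro sum_nonneg) auto
  show ?thesis
  proof (cases "s = 0")
    case True
    have "u j = 0" if "j \<in> J" for j
      using that assms(1) True unfolding s_def by (subst (asm) sum_nonneg_eq_0_iff) auto
    have "(\<Prod>j\<in>T. u j) = 0" if T: "T \<in> {T \<in> Pow J. card T = m}" for T
    proof -
      obtain a where "a \<in> T" using T assms(3) by (cases "T = {}") auto
      then show ?thesis
        using T assms(1) \<open>\<And>j. j \<in> J \<Longrightarrow> u j = 0\<close> finite_subset[of T J] by (intro prod_zero) auto
    qed
    then have "esym J m u = 0" unfolding esym_def by (intro sum.neutral) auto
    then show ?thesis by (simp add: sum_nonneg)
  next
    case False
    then have s: "s > 0" using \<open>s \<ge> 0\<close> by simp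
    define w where "w = sqrt (real (N - m) / real N)"
    define r where "r = sqrt (real m / s)"
    have w2: "w\<^sup>2 = real (N - m) / real N" and r2: "r\<^sup>2 = real m / s" and r0: "r > 0"
      and w0: "w \<ge> 0"
      using s assms by (auto simp: w_def r_def)
    define p where "p = (\<Sum>i\<le>N. monom (esym J i u * of_real w ^ (N - i)) i)"
    have p_eq: "poly p z = (\<Prod>j\<in>J. of_real w + z * u j)" for z
      by (simp add: p_def poly_sum poly_monom prod_add_scaled[OF assms(1)] N_def)
    have coeff: "coeff p m = esym J m u * of_real w ^ (N - m)"
      using assms by (simp add: p_def coeff_sum N_def)
    have "norm (poly p z) \<le> 1" if z: "norm z = r" for z
    proof -
      have cross: "(\<Sum>j\<in>J. Re (z * u j)) = 0"
      proof -
        have "(\<Sum>j\<in>J. Re (z * u j)) = Re (z * (\<Sum>j\<in>J. u j))"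
          by (simp only: sum_distrib_left Re_sum)
        then show ?thesis using assms(2) by simp
      qed
      have "(norm (of_real w + z * u j))\<^sup>2 = w\<^sup>2 + r\<^sup>2 * (norm (u j))\<^sup>2 + 2 * w * Re (z * u j)" for j
      proof -
        have "(norm (of_real w + v))\<^sup>2 = w\<^sup>2 + (norm v)\<^sup>2 + 2 * w * Re v" for v :: complex
          unfolding cmod_power2 by (simp add: power2_eq_square algebra_simps)
        then show ?thesis by (simp add: norm_mult z power_mult_distrib)
      qed
      then have "(\<Sum>j\<in>J. (norm (of_real w + z * u j))\<^sup>2) = real N * w\<^sup>2 + r\<^sup>2 * s"
        using cross by (simp add: sum.distrib sum_distrib_left[symmetric] s_def N_def)
      also have "\<dots> = real N"
        using N s assms(3) assms(4)[folded N_def] by (simp add: w2 r2)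
      finally have sum_eq: "(\<Sum>j\<in>J. (norm (of_real w + z * u j))\<^sup>2) = real N" .
      have "(norm (poly p z))\<^sup>2 = (\<Prod>j\<in>J. (norm (of_real w + z * u j))\<^sup>2)"
        by (simp add: p_eq prod_norm[symmetric] prod_power_distrib)
      also have "\<dots> \<le> 1"
        using prod_le_mean_power[OF assms(1), of "\<lambda>j. (norm (of_real w + z * u j))\<^sup>2"] N
        by (simp add: sum_eq N_def[symmetric])
      finally show ?thesis by (simp add: abs_square_le_1 power2_le_imp_le[of _ 1])
    qed
    then have "norm (coeff p m) * r ^ m \<le> 1" by (rule cauchy_coeff_bound[OF r0])
    then have "(norm (coeff p m) * r ^ m)\<^sup>2 \<le> 1"
      using r0 by (simp add: power_le_one)
    moreover have "(norm (coeff p m) * r ^ m)\<^sup>2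
        = (norm (esym J m u))\<^sup>2 * (w\<^sup>2) ^ (N - m) * (r\<^sup>2) ^ m"
      using w0 by (simp add: coeff norm_mult norm_power power_mult_distrib power_mult[symmetric] mult.commute)
    ultimately have "(norm (esym J m u))\<^sup>2 * (real (N - m) / real N) ^ (N - m) * (real m / s) ^ m \<le> 1"
      by (simp add: w2 r2)
    then have "(norm (esym J m u))\<^sup>2 * (real (N - m) ^ (N - m) * real m ^ m)
        \<le> real N ^ (N - m) * s ^ m"
      using N s by (simp add: power_divide field_simps)
    then show ?thesis by (simp add: N_def s_def)
  qed
qed

text \<open>
  The sequence \<open>k\<^sup>k e\<^sup>-\<^sup>k / k!\<close> decreases; compare its members at \<open>N - m\<close> and \<open>N\<close>.
\<close>
lemma power_self_le_exp_fact:
  assumes "m \<le> N"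
  shows "real N ^ N * fact (N - m) \<le> exp (real m) * fact N * real (N - m) ^ (N - m)"
proof -
  have one_step: "real (Suc k) ^ k \<le> exp 1 * real k ^ k" for k
  proof (cases "k = 0")
    case False
    have "(1 + 1 / real k) ^ k \<le> exp (1 / real k) ^ k"
      by (intro power_mono) auto
    also have "\<dots> = exp 1" using False by (simp add: exp_of_nat_mult[symmetric])
    finally have "(1 + 1 / real k) ^ k * real k ^ k \<le> exp 1 * real k ^ k"
      by (intro mult_right_mono) auto
    moreover have "(1 + 1 / real k) ^ k * real k ^ k = real (Suc k) ^ k"
      using False by (simp add: power_mult_distrib[symmetric] field_simps)
    ultimately show ?thesis by simp
  qed simp
  have "real (M + m) ^ (M + m) * fact M \<le> exp (real m) * fact (M + m) * real M ^ M" for M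
  proof (induction m)
    case 0
    then show ?case by simp
  next
    case (Suc m)
    have "real (M + Suc m) ^ (M + Suc m) * fact M
        = real (Suc (M + m)) * (real (Suc (M + m)) ^ (M + m) * fact M)" by simp
    also have "\<dots> \<le> real (Suc (M + m)) * (exp 1 * real (M + m) ^ (M + m) * fact M)"
      using one_step[of "M + m"] by (intro mult_left_mono mult_right_mono) auto
    also have "\<dots> = real (Suc (M + m)) * exp 1 * (real (M + m) ^ (M + m) * fact M)" by simp
    also have "\<dots> \<le> real (Suc (M + m)) * exp 1 * (exp (real m) * fact (M + m) * real M ^ M)"
      using Suc by (intro mult_left_mono) auto
    also have "\<dots> = exp (real (Suc m)) * fact (M + Suc m) * real M ^ M"
      by (simp add: exp_add mult_ac)
    finally show ?case .
  qed
  from this[of "N - m"] show ?thesis using assms by simp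
qed

section \<open>Banach's theorem on symmetric multilinear forms\<close>

text \<open>
  Vectors are functions that matter on a finite index set only. The dimension can then vary within
  one statement, which a vector space given by a type would not permit.
\<close>
definition sqnorm :: "'i set \<Rightarrow> ('i \<Rightarrow> complex) \<Rightarrow> real" where
  "sqnorm I v = (\<Sum>i\<in>I. (norm (v i))\<^sup>2)"

lemma sqnorm_nonneg: "sqnorm I v \<ge> 0"
  unfolding sqnorm_def by (intro sum_nonneg) auto

lemma sqnorm_eq_0_D: "finite I \<Longrightarrow> sqnorm I v = 0 \<Longrightarrow> i \<in> I \<Longrightarrow> v i = 0"
  unfolding sqnorm_def by (subst (asm) sum_nonneg_eq_0_iff) auto

lemma sqnorm_scale: "sqnorm I (\<lambda>i. a * v i) = (norm a)\<^sup>2 * sqnorm I v"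
  by (simp add: sqnorm_def norm_mult power_mult_distrib sum_distrib_left)

lemma sqnorm_parallelogram:
  "sqnorm I (\<lambda>i. x i + y i) + sqnorm I (\<lambda>i. x i - y i) = 2 * sqnorm I x + 2 * sqnorm I y"
proof -
  have "(norm (a + b))\<^sup>2 + (norm (a - b))\<^sup>2 = 2 * (norm a)\<^sup>2 + 2 * (norm b)\<^sup>2" for a b :: complex
    unfolding cmod_power2 by (simp add: power2_eq_square algebra_simps)
  then have "(\<Sum>i\<in>I. (norm (x i + y i))\<^sup>2 + (norm (x i - y i))\<^sup>2) =
      (\<Sum>i\<in>I. 2 * (norm (x i))\<^sup>2 + 2 * (norm (y i))\<^sup>2)"
    by (intro sum.cong refl)
  then show ?thesis
    by (simp add: sqnorm_def sum.distrib sum_distrib_left)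
qed

text \<open>
  Tychonoff's theorem, once for the entries of a column and once for the columns.
\<close>
lemma compact_matrices:
  fixes I :: "'i set" and K :: "'k set"
  shows "compact {X :: 'k \<Rightarrow> 'i \<Rightarrow> complex. \<forall>k i.
    (if k \<in> K \<and> i \<in> I then norm (X k i) \<le> 1 else X k i = 0)}"
proof -
  define C where "C k i = (if k \<in> K \<and> i \<in> I then cball (0::complex) 1 else {0})" for k i
  have "compactin (product_topology (\<lambda>_. euclidean) UNIV) (PiE UNIV (C k))" for k
    unfolding compactin_PiE by (auto simp: C_def)
  then have "compact (PiE UNIV (C k))" for k
    by (simp add: euclidean_product_topology flip: compactin_euclidean_iff)
  then have "compactin (product_topology (\<lambda>_. euclidean) UNIV) (PiE UNIV (\<lambda>k. PiE UNIV (C k)))"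
    unfolding compactin_PiE by auto
  then have "compact (PiE UNIV (\<lambda>k. PiE UNIV (C k)))"
    by (simp add: euclidean_product_topology flip: compactin_euclidean_iff)
  moreover have "PiE UNIV (\<lambda>k. PiE UNIV (C k)) = {X. \<forall>k i.
    (if k \<in> K \<and> i \<in> I then norm (X k i) \<le> 1 else X k i = 0)}"
    by (auto simp: PiE_def Pi_def C_def split: if_splits)
  ultimately show ?thesis by simp
qed

text \<open>
  A symmetric multilinear form in the columns \<open>X k\<close>, \<open>k \<in> K\<close>, each of which ranges over a
  complex vector space \<open>V\<close> of vectors supported in \<open>I\<close>. Form and space live on total functions, so
  closedness of \<open>V\<close> and continuity of \<open>L\<close> refer to the product topology.
\<close>
locale symmetric_multilinear_form =
  fixes K :: "'k set" and I :: "'i set" and V :: "('i \<Rightarrow> complex) set"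
    and L :: "('k \<Rightarrow> 'i \<Rightarrow> complex) \<Rightarrow> complex"
  assumes finite_K: "finite K" and finite_I: "finite I"
    and supported: "\<And>v i. v \<in> V \<Longrightarrow> i \<notin> I \<Longrightarrow> v i = 0"
    and zero_mem: "(\<lambda>_. 0) \<in> V"
    and lincomb_mem: "\<And>a b v w. v \<in> V \<Longrightarrow> w \<in> V \<Longrightarrow> (\<lambda>i. a * v i + b * w i) \<in> V"
    and closed_V: "closed V"
    and local: "\<And>X Y. (\<And>k. k \<in> K \<Longrightarrow> X k = Y k) \<Longrightarrow> L X = L Y"
    and linear: "\<And>X k a b v w. k \<in> K \<Longrightarrow>
      L (X(k := \<lambda>i. a * v i + b * w i)) = a * L (X(k := v)) + b * L (X(k := w))"
    and symmetric: "\<And>X k l v w. k \<in> K \<Longrightarrow> l \<in> K \<Longrightarrow> k \<noteq> l \<Longrightarrow>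
      L (X(k := v, l := w)) = L (X(k := w, l := v))"
    and continuous: "continuous_on UNIV L"
begin

lemma scale_mem: "v \<in> V \<Longrightarrow> (\<lambda>i. a * v i) \<in> V"
  using lincomb_mem[of v v a 0] by simp

lemma scale_col: "k \<in> K \<Longrightarrow> L (X(k := \<lambda>i. a * v i)) = a * L (X(k := v))"
  using linear[of k X a v 0 v] by simp

lemma scale_cols:
  assumes "F \<subseteq> K"
  shows "L (\<lambda>k i. if k \<in> F then a k * X k i else X k i) = (\<Prod>k\<in>F. a k) * L X"
  using finite_subset[OF assms finite_K] assms
proof (induction F rule: finite_induct)
  case empty
  then show ?case by simp
next
  case (insert l F)
  let ?X = "\<lambda>k i. if k \<in> F then a k * X k i else X k i"
  have upd: "(\<lambda>k i. if k \<in> insert l F then a k * X k i else X k i) = ?X(l := \<lambda>i. a l * X l i)"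
    using insert.hyps by (auto simp: fun_eq_iff)
  have idle: "?X(l := X l) = ?X" using insert.hyps by (auto simp: fun_eq_iff)
  have "L (?X(l := \<lambda>i. a l * X l i)) = a l * L (?X(l := X l))"
    using insert.prems by (intro scale_col) auto
  also have "\<dots> = a l * ((\<Prod>k\<in>F. a k) * L X)"
    unfolding idle using insert.IH insert.prems by simp
  also have "\<dots> = (\<Prod>k\<in>insert l F. a k) * L X" using insert.hyps by simp
  finally show ?case unfolding upd .
qed

definition unit_tuples :: "('k \<Rightarrow> 'i \<Rightarrow> complex) set" where
  "unit_tuples = {X. (\<forall>k\<in>K. X k \<in> V \<and> sqnorm I (X k) \<le> 1) \<and> (\<forall>k. k \<notin> K \<longrightarrow> X k = (\<lambda>_. 0))}"

lemma continuous_entry: "continuous_on S (\<lambda>X :: 'k \<Rightarrow> 'i \<Rightarrow> complex. X k i)"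
proof -
  have "continuous_on S (\<lambda>X :: 'k \<Rightarrow> 'i \<Rightarrow> complex. X k)"
    by (rule continuous_on_product_then_coordinatewise[where f = "\<lambda>X. X"]) (rule continuous_on_id)
  then show ?thesis
    by (rule continuous_on_product_then_coordinatewise)
qed

lemma compact_unit_tuples: "compact unit_tuples"
proof -
  let ?B = "{X :: 'k \<Rightarrow> 'i \<Rightarrow> complex. \<forall>k i.
    (if k \<in> K \<and> i \<in> I then norm (X k i) \<le> 1 else X k i = 0)}"
  have entry_le: "norm (v i) \<le> 1" if "sqnorm I v \<le> 1" "i \<in> I" for v i
  proof -
    have "(norm (v i))\<^sup>2 \<le> sqnorm I v"
      unfolding sqnorm_def by (rule member_le_sum) (use that finite_I in auto)
    then show ?thesis using that(1) abs_square_le_1[of "norm (v i)"] by simp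
  qed
  have eq: "unit_tuples = ?B \<inter> (\<Inter>k\<in>K. {X. X k \<in> V} \<inter> {X. sqnorm I (X k) \<le> 1})"
  proof (intro equalityI subsetI)
    fix X assume X: "X \<in> unit_tuples"
    have "if k \<in> K \<and> i \<in> I then norm (X k i) \<le> 1 else X k i = 0" for k i
    proof (cases "k \<in> K")
      case True
      then have "X k \<in> V" "sqnorm I (X k) \<le> 1" using X by (simp_all add: unit_tuples_def)
      then show ?thesis using True entry_le supported by simp
    next
      case False
      then show ?thesis using X by (simp add: unit_tuples_def)
    qed
    then show "X \<in> ?B \<inter> (\<Inter>k\<in>K. {X. X k \<in> V} \<inter> {X. sqnorm I (X k) \<le> 1})"
      using X by (simp add: unit_tuples_def)
  next
    fix X assume X: "X \<in> ?B \<inter> (\<Inter>k\<in>K. {X. X k \<in> V} \<inter> {X. sqnorm I (X k) \<le> 1})"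
    then have entries: "if k \<in> K \<and> i \<in> I then norm (X k i) \<le> 1 else X k i = 0" for k i by blast
    have "X k = (\<lambda>_. 0)" if "k \<notin> K" for k
      using entries[of k] that by (intro ext) simp
    then show "X \<in> unit_tuples" using X unfolding unit_tuples_def by blast
  qed
  have "closed (\<Inter>k\<in>K. {X. X k \<in> V} \<inter> {X :: 'k \<Rightarrow> 'i \<Rightarrow> complex. sqnorm I (X k) \<le> 1})"
  proof (intro closed_INT ballI closed_Int)
    fix k
    show "closed {X :: 'k \<Rightarrow> 'i \<Rightarrow> complex. X k \<in> V}"
      using closed_vimage[OF closed_V, of "\<lambda>X. X k"] by (simp add: vimage_def)
    show "closed {X :: 'k \<Rightarrow> 'i \<Rightarrow> complex. sqnorm I (X k) \<le> 1}"
      unfolding sqnorm_def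
      by (intro closed_Collect_le continuous_on_const continuous_on_sum continuous_on_power
          continuous_on_norm continuous_entry)
  qed
  then show ?thesis unfolding eq by (rule compact_Int_closed[OF compact_matrices])
qed

text \<open>
  Scaling: a bound on tuples of vectors of length at most one determines the bound on all tuples.
\<close>
lemma norm_le_of_unit_bound:
  assumes unit: "\<And>X. X \<in> unit_tuples \<Longrightarrow> norm (L X) \<le> M" and X: "\<And>k. k \<in> K \<Longrightarrow> X k \<in> V"
  shows "norm (L X) \<le> M * (\<Prod>k\<in>K. sqrt (sqnorm I (X k)))"
proof (cases "\<exists>k\<in>K. sqnorm I (X k) = 0")
  case True
  then obtain k where k: "k \<in> K" "sqnorm I (X k) = 0" by blast
  have X_k: "X k = (\<lambda>i. 0 * X k i)"
  proof (intro ext)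
    fix i show "X k i = 0 * X k i"
      using sqnorm_eq_0_D[OF finite_I k(2), of i] supported[OF X[OF k(1)], of i] by (cases "i \<in> I") auto
  qed
  have "L X = L (X(k := \<lambda>i. 0 * X k i))"
    by (simp only: X_k[symmetric] fun_upd_triv)
  then have "L X = 0"
    using scale_col[OF k(1), of X 0 "X k"] by simp
  moreover have "(\<Prod>k\<in>K. sqrt (sqnorm I (X k))) = 0"
    using k finite_K by (intro prod_zero) auto
  ultimately show ?thesis by simp
next
  case False
  then have pos: "sqnorm I (X k) > 0" if "k \<in> K" for k
    using that sqnorm_nonneg[of I "X k"] by force
  define a where "a k = complex_of_real (1 / sqrt (sqnorm I (X k)))" for k
  define Y where "Y = (\<lambda>k i. if k \<in> K then a k * X k i else 0)"
  have "(norm (a k))\<^sup>2 * sqnorm I (X k) = 1" if "k \<in> K" for k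
    using pos[OF that] by (simp add: a_def norm_divide power_divide)
  then have "Y \<in> unit_tuples"
    using X by (auto simp: unit_tuples_def Y_def scale_mem sqnorm_scale)
  then have "norm (L Y) \<le> M" by (rule unit)
  moreover have "L Y = (\<Prod>k\<in>K. a k) * L X"
    unfolding scale_cols[OF order_refl, symmetric] by (rule local) (simp add: Y_def)
  moreover have "norm (\<Prod>k\<in>K. a k) = inverse (\<Prod>k\<in>K. sqrt (sqnorm I (X k)))"
  proof -
    have "norm (a k) = inverse (sqrt (sqnorm I (X k)))" if "k \<in> K" for k
      using pos[OF that] by (simp add: a_def norm_divide inverse_eq_divide)
    then show ?thesis by (simp add: prod_norm[symmetric] prod_inversef[unfolded o_def])
  qed
  moreover have "(\<Prod>k\<in>K. sqrt (sqnorm I (X k))) > 0"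
    using pos by (intro prod_pos) auto
  ultimately show ?thesis by (simp add: norm_mult field_simps)
qed

text \<open>
  The replacement of two members of a unit tuple is the step by which tuples are improved below.
\<close>
lemma norm_two_columns_le:
  assumes unit: "\<And>X. X \<in> unit_tuples \<Longrightarrow> norm (L X) \<le> M" and "M \<ge> 0"
    and "X \<in> unit_tuples" "k \<in> K" "l \<in> K" "k \<noteq> l" "v \<in> V" "w \<in> V"
  shows "norm (L (X(k := v, l := w))) \<le> M * (sqrt (sqnorm I v) * sqrt (sqnorm I w))"
proof -
  let ?Y = "X(k := v, l := w)"
  have "norm (L ?Y) \<le> M * (\<Prod>j\<in>K. sqrt (sqnorm I (?Y j)))"
    by (rule norm_le_of_unit_bound[OF unit]) (use assms in \<open>auto simp: unit_tuples_def\<close>)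
  also have "(\<Prod>j\<in>K. sqrt (sqnorm I (?Y j))) =
      sqrt (sqnorm I v) * (sqrt (sqnorm I w) * (\<Prod>j\<in>K - {k} - {l}. sqrt (sqnorm I (X j))))"
  proof -
    have "(\<Prod>j\<in>K - {k} - {l}. sqrt (sqnorm I (?Y j))) = (\<Prod>j\<in>K - {k} - {l}. sqrt (sqnorm I (X j)))"
      by (intro prod.cong) auto
    moreover have "l \<in> K - {k}" using assms by simp
    ultimately show ?thesis
      using assms(6) prod.remove[OF finite_K \<open>k \<in> K\<close>, of "\<lambda>j. sqrt (sqnorm I (?Y j))"]
        prod.remove[of "K - {k}" l "\<lambda>j. sqrt (sqnorm I (?Y j))"] finite_K by simp
  qed
  also have "M * \<dots> \<le> M * (sqrt (sqnorm I v) * (sqrt (sqnorm I w) * 1))"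
    using assms by (intro mult_left_mono prod_le_1) (auto simp: unit_tuples_def sqnorm_nonneg)
  also have "M * (sqrt (sqnorm I v) * (sqrt (sqnorm I w) * 1)) = M * (sqrt (sqnorm I v) * sqrt (sqnorm I w))"
    by simp
  finally show ?thesis .
qed

lemma polarization:
  assumes "k \<in> K" "l \<in> K" "k \<noteq> l"
  shows "4 * L (X(k := v, l := w)) =
    L (X(k := \<lambda>i. v i + w i, l := \<lambda>i. v i + w i)) - L (X(k := \<lambda>i. v i - w i, l := \<lambda>i. v i - w i))"
proof -
  define B where "B p q = L (X(k := p, l := q))" for p q
  have right: "B p (\<lambda>i. v i + b * w i) = B p v + b * B p w" for p b
    using linear[OF assms(2), of "X(k := p)" 1 v b w] by (simp add: B_def)
  have left: "B (\<lambda>i. v i + b * w i) q = B v q + b * B w q" for q b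
    using linear[OF assms(1), of "X(l := q)" 1 v b w] assms(3) by (simp add: B_def fun_upd_twist)
  have "B w v = B v w"
    using symmetric[OF assms, of X w v] by (simp add: B_def)
  then have "4 * B v w = B (\<lambda>i. v i + 1 * w i) (\<lambda>i. v i + 1 * w i) -
      B (\<lambda>i. v i + (-1) * w i) (\<lambda>i. v i + (-1) * w i)"
    unfolding right left by simp
  then show ?thesis by (simp add: B_def)
qed

text \<open>
  Let \<open>M\<close> be the maximum of \<open>|L|\<close> over unit tuples. If two members \<open>x\<close>, \<open>y\<close> of a maximizing tuple are
  both replaced by the normalized sum \<open>w = (x + y) / |x + y|\<close>, the tuple is still maximizing: with the
  other columns fixed, polarization gives
  \<open>4 M \<le> |L(x + y, x + y)| + M |x - y|\<^sup>2\<close>, hence \<open>|L(x + y, x + y)| \<ge> M |x + y|\<^sup>2\<close> by the parallelogram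
  law. To make such replacements stop, one picks among the maximizing tuples one that maximizes
  \<open>\<Sum>\<^sub>k |\<langle>X\<^sub>k, v\<rangle>|\<close> for a fixed vector \<open>v\<close>. After a change of phase of \<open>y\<close> the replacement multiplies the
  contribution \<open>|\<langle>x, v\<rangle>| + |\<langle>y, v\<rangle>|\<close> of the two columns by \<open>2 / |x + y|\<close>, so \<open>|x + y| \<ge> 2\<close> and \<open>x = y\<close>. Hence all
  columns agree up to phases, and \<open>M\<close> is attained on the diagonal.
\<close>
theorem banach_norm_bound:
  assumes diag: "\<And>v. v \<in> V \<Longrightarrow> sqnorm I v = 1 \<Longrightarrow> norm (L (\<lambda>_. v)) \<le> c"
    and "c \<ge> 0" "K \<noteq> {}" "\<And>k. k \<in> K \<Longrightarrow> X k \<in> V"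
  shows "norm (L X) \<le> c * (\<Prod>k\<in>K. sqrt (sqnorm I (X k)))"
proof -
  have "(\<lambda>_ _. 0) \<in> unit_tuples"
    using zero_mem by (simp add: unit_tuples_def sqnorm_def)
  then have "unit_tuples \<noteq> {}" by blast
  moreover have "continuous_on unit_tuples (\<lambda>X. norm (L X))"
    by (rule continuous_on_norm[OF continuous_on_subset[OF continuous subset_UNIV]])
  ultimately have "\<exists>Y\<in>unit_tuples. \<forall>X\<in>unit_tuples. norm (L X) \<le> norm (L Y)"
    by (rule continuous_attains_sup[OF compact_unit_tuples])
  then obtain Y where Y: "Y \<in> unit_tuples"
    and Y_max: "\<And>X. X \<in> unit_tuples \<Longrightarrow> norm (L X) \<le> norm (L Y)" by blast
  define M where "M = norm (L Y)"
  have "M \<le> c"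
  proof (cases "M = 0")
    case False
    then have M: "M > 0" by (simp add: M_def)
    have M_bound: "norm (L X) \<le> M" if "X \<in> unit_tuples" for X using Y_max[OF that] by (simp add: M_def)
    have col_unit: "sqnorm I (X k) = 1" if X: "X \<in> unit_tuples" "norm (L X) = M" and k: "k \<in> K" for X k
    proof -
      have "M \<le> M * (\<Prod>j\<in>K. sqrt (sqnorm I (X j)))"
        unfolding that(2)[symmetric]
        by (rule norm_le_of_unit_bound) (use X M_bound in \<open>auto simp: unit_tuples_def\<close>)
      also have "(\<Prod>j\<in>K. sqrt (sqnorm I (X j))) =
          sqrt (sqnorm I (X k)) * (\<Prod>j\<in>K - {k}. sqrt (sqnorm I (X j)))"
        by (rule prod.remove[OF finite_K k])
      also have "M * \<dots> \<le> M * (sqrt (sqnorm I (X k)) * 1)"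
        using X M by (intro mult_left_mono prod_le_1) (auto simp: unit_tuples_def sqnorm_nonneg)
      finally have "1 \<le> sqnorm I (X k)" using M by simp
      then show ?thesis using X k by (auto simp: unit_tuples_def intro: antisym)
    qed
    obtain k0 where k0: "k0 \<in> K" using assms by blast
    \<comment> \<open>The fixed vector is a column of one maximizing tuple, which ensures that the maximum of \<open>\<Phi>\<close> is positive.\<close>
    define ip where "ip x = (\<Sum>i\<in>I. x i * cnj (Y k0 i))" for x
    define \<Phi> where "\<Phi> X = (\<Sum>k\<in>K. norm (ip (X k)))" for X
    have ip_lin: "ip (\<lambda>i. a * x i + b * y i) = a * ip x + b * ip y" for a b x y
      by (simp add: ip_def sum.distrib sum_distrib_left algebra_simps)
    let ?T = "{X \<in> unit_tuples. norm (L X) = M}"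
    have "compact ?T"
    proof -
      have "closed {X. norm (L X) = M}"
        by (intro closed_Collect_eq continuous_on_norm continuous continuous_on_const)
      then have "compact (unit_tuples \<inter> {X. norm (L X) = M})"
        by (intro compact_Int_closed compact_unit_tuples)
      then show ?thesis by (simp add: Int_def)
    qed
    moreover have "Y \<in> ?T" using Y by (simp add: M_def)
    moreover have "continuous_on ?T \<Phi>"
      unfolding \<Phi>_def ip_def
      by (intro continuous_on_sum continuous_on_norm continuous_on_mult continuous_on_const continuous_entry)
    ultimately have "\<exists>X\<in>?T. \<forall>X'\<in>?T. \<Phi> X' \<le> \<Phi> X"
      by (intro continuous_attains_sup) auto
    then obtain X where X: "X \<in> unit_tuples" "norm (L X) = M"
      and X_max: "\<And>X'. X' \<in> unit_tuples \<Longrightarrow> norm (L X') = M \<Longrightarrow> \<Phi> X' \<le> \<Phi> X"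
      by blast
    have XV: "X k \<in> V" if "k \<in> K" for k using X that by (simp add: unit_tuples_def)
    have "\<Phi> X > 0"
    proof -
      have "ip (Y k0) = complex_of_real (sqnorm I (Y k0))"
        by (simp add: ip_def sqnorm_def flip: complex_norm_square)
      then have "norm (ip (Y k0)) = 1"
        using col_unit[OF Y _ k0] by (simp add: M_def)
      moreover have "norm (ip (Y k0)) \<le> \<Phi> Y"
        unfolding \<Phi>_def by (rule member_le_sum) (use k0 finite_K in auto)
      ultimately show ?thesis using X_max[OF Y] by (simp add: M_def)
    qed
    obtain k where k: "k \<in> K" "ip (X k) \<noteq> 0"
    proof -
      have "\<exists>k\<in>K. ip (X k) \<noteq> 0"
      proof (rule ccontr)
        assume "\<not> (\<exists>k\<in>K. ip (X k) \<noteq> 0)"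
        then have "\<Phi> X = 0" unfolding \<Phi>_def by (intro sum.neutral) auto
        then show False using \<open>\<Phi> X > 0\<close> by simp
      qed
      then show ?thesis using that by blast
    qed
    have aligned: "\<exists>u. norm u = 1 \<and> (\<forall>i. X k i = u * X l i)" if l: "l \<in> K" for l
    proof (cases "l = k")
      case True
      then show ?thesis by (intro exI[of _ 1]) simp
    next
      case False
      define a where "a = ip (X k)"
      define b where "b = ip (X l)"
      \<comment> \<open>The phase \<open>u\<close> turns \<open>b\<close> into the direction of \<open>a\<close>.\<close>
      obtain u where u: "norm u = 1" "norm (a + u * b) = norm a + norm b"
      proof (cases "b = 0")
        case True
        then show ?thesis by (intro that[of 1]) auto
      next
        case False
        define u where "u = sgn a / sgn b"
        have "a = norm a * sgn a" "b = norm b * sgn b"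
          by (simp_all add: sgn_eq)
        moreover have "sgn b \<noteq> 0" using False by (simp add: sgn_zero_iff)
        ultimately have "a + u * b = of_real (norm a + norm b) * sgn a"
          by (simp add: u_def field_simps)
        then have "norm (a + u * b) = norm a + norm b"
          using k(2) by (simp add: a_def norm_mult norm_sgn del: of_real_add)
        moreover have "norm u = 1"
          using k(2) False by (simp add: u_def a_def norm_divide norm_sgn)
        ultimately show ?thesis by (intro that)
      qed
      define y where "y = (\<lambda>i. u * X l i)"
      define z where "z = (\<lambda>i. X k i + y i)"
      define d where "d = (\<lambda>i. X k i - y i)"
      have yV: "y \<in> V" unfolding y_def using XV[OF l] by (rule scale_mem)
      have zV: "z \<in> V" and dV: "d \<in> V"
        using lincomb_mem[OF XV[OF k(1)] yV, of 1 1] lincomb_mem[OF XV[OF k(1)] yV, of 1 "-1"]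
        by (simp_all add: z_def d_def)
      have sum4: "sqnorm I z + sqnorm I d = 4"
        using sqnorm_parallelogram[of I "X k" y] col_unit[OF X k(1)] col_unit[OF X l] u(1)
        by (simp add: z_def d_def y_def sqnorm_scale)
      have ip_z: "norm (ip z) = norm a + norm b"
        using ip_lin[of 1 "X k" u "X l"] u(2) by (simp add: z_def y_def a_def b_def)
      have ab: "norm a + norm b > 0" using k(2) by (simp add: a_def add_pos_nonneg)
      have z_pos: "sqnorm I z > 0"
      proof (rule ccontr)
        assume "\<not> sqnorm I z > 0"
        then have "sqnorm I z = 0" using sqnorm_nonneg[of I z] by simp
        then have "ip z = 0" unfolding ip_def using sqnorm_eq_0_D[OF finite_I, of z]
          by (intro sum.neutral) auto
        then show False using ip_z ab by simp
      qed
      have kl: "k \<noteq> l" using False by simp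
      have two: "norm (L (X(k := v, l := v))) \<le> M * sqnorm I v" if "v \<in> V" for v
        using norm_two_columns_le[OF M_bound _ X(1) k(1) l kl that that] M sqnorm_nonneg[of I v]
        by simp
      have lower: "M * sqnorm I z \<le> norm (L (X(k := z, l := z)))"
      proof -
        have "L (X(k := X k, l := y)) = u * L X"
          unfolding y_def using scale_col[OF l, of "X(k := X k)" u "X l"] by simp
        then have "4 * M = norm (4 * L (X(k := X k, l := y)))"
          using u(1) X(2) by (simp add: norm_mult)
        also have "\<dots> \<le> norm (L (X(k := z, l := z))) + norm (L (X(k := d, l := d)))"
          unfolding polarization[OF k(1) l kl] z_def d_def by (rule norm_triangle_ineq4)
        also have "norm (L (X(k := d, l := d))) \<le> M * sqnorm I d" by (rule two[OF dV])
        finally have "4 * M - M * sqnorm I d \<le> norm (L (X(k := z, l := z)))" by linarith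
        moreover have "4 * M - M * sqnorm I d = M * sqnorm I z"
          by (subst sum4[symmetric]) (simp add: algebra_simps)
        ultimately show ?thesis by linarith
      qed
      define r where "r = sqrt (sqnorm I z)"
      have r: "r > 0" "r\<^sup>2 = sqnorm I z" using z_pos by (simp_all add: r_def)
      define w where "w = (\<lambda>i. of_real (1 / r) * z i)"
      define X' where "X' = X(k := w, l := w)"
      have X'_unit: "X' \<in> unit_tuples"
      proof -
        have "w \<in> V" unfolding w_def by (rule scale_mem[OF zV])
        moreover have "sqnorm I w = 1"
          unfolding w_def sqnorm_scale r(2)[symmetric] using r(1) by (simp add: norm_divide power_divide)
        ultimately show ?thesis using X k(1) l by (auto simp: unit_tuples_def X'_def)
      qed
      have "L X' = of_real (1 / r) * (of_real (1 / r) * L (X(k := z, l := z)))"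
      proof -
        have "L X' = of_real (1 / r) * L (X(k := w, l := z))"
          unfolding X'_def w_def by (rule scale_col[OF l])
        also have "L (X(k := w, l := z)) = L ((X(l := z))(k := w))"
          using kl by (simp add: fun_upd_twist)
        also have "\<dots> = of_real (1 / r) * L ((X(l := z))(k := z))"
          unfolding w_def by (rule scale_col[OF k(1)])
        also have "(X(l := z))(k := z) = X(k := z, l := z)" using kl by (simp add: fun_upd_twist)
        finally show ?thesis .
      qed
      then have "norm (L X') = norm (L (X(k := z, l := z))) / r\<^sup>2"
        using r(1) by (simp add: norm_mult norm_divide power2_eq_square)
      then have "norm (L X') \<ge> M"
        using lower r z_pos by (simp add: le_divide_eq)
      then have "norm (L X') = M" using M_bound[OF X'_unit] by simp
      then have "\<Phi> X' \<le> \<Phi> X" by (rule X_max[OF X'_unit])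
      moreover have split: "\<Phi> W = norm (ip (W k)) + (norm (ip (W l)) + (\<Sum>j\<in>K - {k} - {l}. norm (ip (W j))))" for W
        using l kl finite_K sum.remove[OF finite_K k(1), of "\<lambda>j. norm (ip (W j))"]
          sum.remove[of "K - {k}" l "\<lambda>j. norm (ip (W j))"] by (simp add: \<Phi>_def)
      ultimately have "2 * norm (ip w) \<le> norm a + norm b"
        using kl unfolding split by (simp add: X'_def a_def b_def)
      moreover have "norm (ip w) = (norm a + norm b) / r"
        using ip_lin[of "of_real (1 / r)" z 0 z] r(1) ip_z by (simp add: w_def norm_mult norm_divide)
      ultimately have "2 * (norm a + norm b) \<le> r * (norm a + norm b)"
        using r(1) by (simp add: field_simps)
      then have "2 \<le> r" using ab by (simp only: mult_le_cancel_right_pos)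
      then have "2\<^sup>2 \<le> r\<^sup>2" by (intro power_mono) auto
      then have "sqnorm I d = 0" using sum4 r(2) sqnorm_nonneg[of I d] by simp
      then have "d i = 0" for i
        using sqnorm_eq_0_D[OF finite_I, of d i] supported[OF dV, of i] by (cases "i \<in> I") auto
      then show ?thesis using u(1) by (intro exI[of _ u]) (simp add: d_def y_def)
    qed
    then have "\<forall>l\<in>K. \<exists>u. norm u = 1 \<and> (\<forall>i. X k i = u * X l i)" by blast
    then obtain u where u': "\<forall>l\<in>K. norm (u l) = 1 \<and> (\<forall>i. X k i = u l * X l i)"
      unfolding bchoice_iff by blast
    then have u: "\<And>l. l \<in> K \<Longrightarrow> norm (u l) = 1" "\<And>l i. l \<in> K \<Longrightarrow> X k i = u l * X l i"
      by blast+
    have "L (\<lambda>_. X k) = (\<Prod>l\<in>K. u l) * L X"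
      unfolding scale_cols[OF order_refl, symmetric]
    proof (rule local)
      fix l assume l: "l \<in> K"
      show "X k = (\<lambda>i. if l \<in> K then u l * X l i else X l i)"
      proof (intro ext)
        fix i show "X k i = (if l \<in> K then u l * X l i else X l i)"
          using u(2)[OF l, of i] l by simp
      qed
    qed
    then have "M = norm (L (\<lambda>_. X k))"
      using u(1) X(2) by (simp add: norm_mult prod_norm[symmetric])
    also have "\<dots> \<le> c" using diag XV k(1) col_unit[OF X k(1)] by simp
    finally show ?thesis .
  qed (use assms in simp)
  have "norm (L X) \<le> M * (\<Prod>k\<in>K. sqrt (sqnorm I (X k)))"
    by (rule norm_le_of_unit_bound) (use Y_max assms in \<open>auto simp: M_def\<close>)
  also have "\<dots> \<le> c * (\<Prod>k\<in>K. sqrt (sqnorm I (X k)))"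
    using \<open>M \<le> c\<close> by (intro mult_right_mono prod_nonneg) (auto simp: sqnorm_nonneg)
  finally show ?thesis .
qed

end

section \<open>The size of the individual terms\<close>

text \<open>
  Expanding along both columns reduces the exchange of columns to the exchange of two summations.
\<close>
lemma rperm_swap_columns:
  fixes A :: "'i \<Rightarrow> 'k \<Rightarrow> 'a::comm_semiring_1"
  assumes "finite J" "finite S" "k \<in> S" "l \<in> S" "k \<noteq> l"
    and "\<And>j m. m \<noteq> k \<Longrightarrow> m \<noteq> l \<Longrightarrow> B j m = A j m"
    and "\<And>j. B j k = A j l" "\<And>j. B j l = A j k"
  shows "rperm J S B = rperm J S A"
proof -
  define R where "R = S - {k, l}"
  have S: "S = insert k (insert l R)" using assms by (auto simp: R_def)
  have R: "finite R" "k \<notin> insert l R" "l \<notin> R" using assms by (auto simp: R_def)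
  have expand: "rperm J S C = (\<Sum>y\<in>J. \<Sum>z\<in>{z \<in> J. z \<noteq> y}. C y k * C z l * rperm (J - {y, z}) R C)"
    for C :: "'i \<Rightarrow> 'k \<Rightarrow> 'a"
  proof -
    have "{z \<in> J. z \<noteq> y} = J - {y}" "J - {y} - {z} = J - {y, z}" for y z by auto
    then show ?thesis
      unfolding S using assms(1) R by (simp add: rperm_insert_col sum_distrib_left mult.assoc)
  qed
  have "rperm J S B = (\<Sum>y\<in>J. \<Sum>z\<in>{z \<in> J. z \<noteq> y}. A z k * A y l * rperm (J - {z, y}) R A)"
    unfolding expand
  proof (intro sum.cong refl)
    fix y z
    have "rperm (J - {y, z}) R B = rperm (J - {y, z}) R A"
      using assms(6) R_def by (intro rperm_cong) auto
    moreover have "{y, z} = {z, y}" by auto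
    ultimately show "B y k * B z l * rperm (J - {y, z}) R B = A z k * A y l * rperm (J - {z, y}) R A"
      using assms(7,8) by (simp add: mult.commute)
  qed
  also have "\<dots> = (\<Sum>z\<in>J. \<Sum>y\<in>{y \<in> J. z \<noteq> y}. A z k * A y l * rperm (J - {z, y}) R A)"
    by (rule sum.swap_restrict) (use assms(1) in auto)
  also have "\<dots> = rperm J S A"
    unfolding expand by (intro sum.cong refl) auto
  finally show ?thesis .
qed

lemma rperm_column_linear:
  fixes X :: "'k \<Rightarrow> 'i \<Rightarrow> 'a::comm_semiring_1"
  assumes "finite J" "finite S" "k \<in> S"
  shows "rperm J S (\<lambda>j l. (X(k := \<lambda>i. a * v i + b * w i)) l j) =
    a * rperm J S (\<lambda>j l. (X(k := v)) l j) + b * rperm J S (\<lambda>j l. (X(k := w)) l j)"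
proof -
  have S: "S = insert k (S - {k})" using assms by auto
  have "rperm J S (\<lambda>j l. (X(k := x)) l j) =
      (\<Sum>y\<in>J. x y * rperm (J - {y}) (S - {k}) (\<lambda>j l. X l j))" for x
  proof -
    have "rperm J S (\<lambda>j l. (X(k := x)) l j) =
        (\<Sum>y\<in>J. x y * rperm (J - {y}) (S - {k}) (\<lambda>j l. (X(k := x)) l j))"
      by (subst S, subst rperm_insert_col) (use assms in auto)
    also have "\<dots> = (\<Sum>y\<in>J. x y * rperm (J - {y}) (S - {k}) (\<lambda>j l. X l j))"
      by (intro sum.cong refl arg_cong2[where f = "(*)"] rperm_cong) auto
    finally show ?thesis .
  qed
  then show ?thesis by (simp add: sum.distrib sum_distrib_left algebra_simps)
qed

text \<open>
  The restriction to sum zero is essential: the bound on the diagonal relies on it, and Banach's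
  theorem has to be applied on a space on which that bound holds.
\<close>
definition centered :: "'i set \<Rightarrow> ('i \<Rightarrow> complex) set" where
  "centered J = {v. (\<forall>i. i \<notin> J \<longrightarrow> v i = 0) \<and> (\<Sum>i\<in>J. v i) = 0}"

lemma continuous_on_coordinate: "continuous_on S (\<lambda>v :: 'i \<Rightarrow> complex. v i)"
  by (rule continuous_on_subset[OF continuous_on_product_coordinates]) simp

lemma closed_centered: "closed (centered J)"
proof -
  have "centered J = (\<Inter>i\<in>-J. {v. v i = 0}) \<inter> {v. (\<Sum>i\<in>J. v i) = 0}"
    by (auto simp: centered_def)
  moreover have "closed {v :: 'a \<Rightarrow> complex. v i = 0}" for i
    by (intro closed_Collect_eq continuous_on_coordinate continuous_on_const)
  moreover have "closed {v :: 'a \<Rightarrow> complex. (\<Sum>i\<in>J. v i) = 0}"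
    by (intro closed_Collect_eq continuous_on_sum continuous_on_coordinate continuous_on_const)
  ultimately show ?thesis by (simp add: closed_Int closed_INT)
qed

lemma continuous_on_rperm:
  "continuous_on UNIV (\<lambda>X :: 'k \<Rightarrow> 'i \<Rightarrow> complex. rperm J S (\<lambda>j k. X k j))"
proof -
  have entry: "continuous_on UNIV (\<lambda>X :: 'k \<Rightarrow> 'i \<Rightarrow> complex. X k i)" for k i
    using continuous_on_product_then_coordinatewise[OF continuous_on_product_coordinates[of k]] .
  show ?thesis
    unfolding rperm_def by (intro continuous_on_sum continuous_on_prod entry)
qed

lemma symmetric_multilinear_form_rperm:
  fixes J :: "'i set" and S :: "'k set"
  assumes "finite J" "finite S"
  shows "symmetric_multilinear_form S J (centered J) (\<lambda>X. rperm J S (\<lambda>j k. X k j))"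
proof
  show "rperm J S (\<lambda>j k. X k j) = rperm J S (\<lambda>j k. Y k j)" if "\<And>k. k \<in> S \<Longrightarrow> X k = Y k" for X Y
    using that by (intro rperm_cong) auto
  show "rperm J S (\<lambda>j m. (X(k := v, l := w)) m j) = rperm J S (\<lambda>j m. (X(k := w, l := v)) m j)"
    if "k \<in> S" "l \<in> S" "k \<noteq> l" for X k l and v w :: "'i \<Rightarrow> complex"
    by (rule rperm_swap_columns[OF assms that]) (use that in auto)
  show "continuous_on UNIV (\<lambda>X :: 'k \<Rightarrow> 'i \<Rightarrow> complex. rperm J S (\<lambda>j k. X k j))" by (rule continuous_on_rperm)
  show "(\<lambda>i. a * v i + b * w i) \<in> centered J" if "v \<in> centered J" "w \<in> centered J" for a b v w
    using that by (simp add: centered_def sum.distrib sum_distrib_left[symmetric])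
  show "rperm J S (\<lambda>j l. (X(k := \<lambda>i. a * v i + b * w i)) l j) =
      a * rperm J S (\<lambda>j l. (X(k := v)) l j) + b * rperm J S (\<lambda>j l. (X(k := w)) l j)"
    if "k \<in> S" for X k a b v w
    by (rule rperm_column_linear[OF assms that])
qed (use assms closed_centered in \<open>auto simp: centered_def\<close>)

text \<open>
  Banach's theorem reduces the claim to equal columns, where the bound for elementary symmetric
  polynomials applies. The comparison of \<open>N\<^sup>N\<^sup>-\<^sup>m / (N - m)\<^sup>N\<^sup>-\<^sup>m\<close> with falling factorials then brings in the
  factor \<open>N! / ((N - m)! N\<^sup>m)\<close>. Together with the binomial coefficient from Maclaurin's inequality it
  will cancel against the square of the normalization of \<open>G\<^sub>m\<close>.
\<close>
lemma norm_rperm_centered_le: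
  fixes A :: "'i \<Rightarrow> 'k \<Rightarrow> complex"
  assumes "finite J" "finite S" "S \<noteq> {}" "card S \<le> card J"
    and "\<And>k. k \<in> S \<Longrightarrow> (\<Sum>j\<in>J. A j k) = 0"
  shows "(norm (rperm J S A))\<^sup>2 \<le>
    (fact (card S))\<^sup>2 * (exp (real (card S)) * fact (card J) /
      (fact (card J - card S) * real (card J) ^ card S * real (card S) ^ card S)) *
    (\<Prod>k\<in>S. \<Sum>j\<in>J. (norm (A j k))\<^sup>2)"
proof -
  define m where "m = card S"
  define N where "N = card J"
  have m: "m \<ge> 1" "m \<le> N" using assms by (auto simp: m_def N_def Suc_le_eq card_gt_0_iff)
  define q where "q = exp (real m) * fact N / (fact (N - m) * real N ^ m * real m ^ m)"
  have q: "q \<ge> 0" by (simp add: q_def)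
  define c where "c = fact m * sqrt q"
  define X where "X = (\<lambda>k j. if j \<in> J then A j k else 0)"
  interpret symmetric_multilinear_form S J "centered J" "\<lambda>X. rperm J S (\<lambda>j k. X k j)"
    using assms(1,2) by (rule symmetric_multilinear_form_rperm)
  have diag: "norm (rperm J S (\<lambda>j k. v j)) \<le> c" if v: "v \<in> centered J" "sqnorm J v = 1" for v
  proof -
    have "(norm (esym J m v))\<^sup>2 * (real (N - m) ^ (N - m) * real m ^ m) \<le> real N ^ (N - m)"
      using norm_esym_le[OF assms(1), of v m] v m by (simp add: centered_def sqnorm_def N_def)
    moreover have "real N ^ N * fact (N - m) \<le> exp (real m) * fact N * real (N - m) ^ (N - m)"
      by (rule power_self_le_exp_fact[OF m(2)])
    moreover have pos: "real (N - m) ^ (N - m) > 0" by (cases "N = m") auto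
    ultimately have "(norm (esym J m v))\<^sup>2 * (real (N - m) ^ (N - m) * real m ^ m) *
        (real N ^ m * fact (N - m)) \<le> exp (real m) * fact N * real (N - m) ^ (N - m)"
    proof -
      have "(norm (esym J m v))\<^sup>2 * (real (N - m) ^ (N - m) * real m ^ m) * (real N ^ m * fact (N - m))
          \<le> real N ^ (N - m) * (real N ^ m * fact (N - m))"
        by (intro mult_right_mono \<open>_ \<le> real N ^ (N - m)\<close>) auto
      also have "\<dots> = real N ^ N * fact (N - m)"
        using m by (simp add: power_add[symmetric])
      also note \<open>real N ^ N * fact (N - m) \<le> _\<close>
      finally show ?thesis .
    qed
    then have "real (N - m) ^ (N - m) * ((norm (esym J m v))\<^sup>2 * (real m ^ m * real N ^ m * fact (N - m)))
        \<le> real (N - m) ^ (N - m) * (exp (real m) * fact N)"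
      by (simp add: mult_ac)
    then have "(norm (esym J m v))\<^sup>2 * (real m ^ m * real N ^ m * fact (N - m)) \<le> exp (real m) * fact N"
      using pos by (simp only: mult_le_cancel_left_pos)
    then have "(norm (esym J m v))\<^sup>2 \<le> q"
      unfolding q_def using m by (subst le_divide_eq) (simp add: mult_ac)
    then have "norm (esym J m v) \<le> sqrt q" by (rule real_le_rsqrt)
    then show ?thesis
      using rperm_equal_columns[OF assms(1,2), of v] by (simp add: c_def m_def[symmetric] norm_mult)
  qed
  have "norm (rperm J S (\<lambda>j k. X k j)) \<le> c * (\<Prod>k\<in>S. sqrt (sqnorm J (X k)))"
    by (rule banach_norm_bound) (use diag q assms in \<open>auto simp: c_def X_def centered_def\<close>)
  moreover have "rperm J S (\<lambda>j k. X k j) = rperm J S A"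
    by (intro rperm_cong) (simp add: X_def)
  ultimately have "(norm (rperm J S A))\<^sup>2 \<le> (c * (\<Prod>k\<in>S. sqrt (sqnorm J (X k))))\<^sup>2"
    by (intro power_mono) auto
  also have "\<dots> = (fact m)\<^sup>2 * q * (\<Prod>k\<in>S. sqnorm J (X k))"
    using q by (simp add: c_def power_mult_distrib prod_power_distrib sqnorm_nonneg)
  also have "(\<Prod>k\<in>S. sqnorm J (X k)) = (\<Prod>k\<in>S. \<Sum>j\<in>J. (norm (A j k))\<^sup>2)"
    by (simp add: sqnorm_def X_def)
  finally show ?thesis by (simp add: q_def m_def N_def)
qed

lemma sum_acoef: "N \<ge> 1 \<Longrightarrow> (\<Sum>j\<in>{1..N}. acoef N Z j k) = 0"
  by (simp add: acoef_def zbar_def sum_subtractf)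

lemma esym_mono_set:
  fixes u :: "'i \<Rightarrow> real"
  assumes "finite J'" "J \<subseteq> J'" "\<And>j. j \<in> J' \<Longrightarrow> u j \<ge> 0"
  shows "esym J m u \<le> esym J' m u"
  unfolding esym_def by (rule sum_mono2) (use assms in \<open>auto intro!: prod_nonneg\<close>)

text \<open>
  Cauchy-Schwarz over the sets \<open>S\<close> separates the permanents from the products of means. Both sums
  of squares are then elementary symmetric polynomials: of the squared column norms, and of the
  squared moduli of the means. Maclaurin's inequality evaluates them.
\<close>
lemma norm_G_le:
  assumes "1 \<le> m" "m \<le> n" "n \<le> N"
  shows "(norm (G N n Z m))\<^sup>2 \<le> exp (real m) * fact m / real m ^ m *
    (real n * alpha N n Z / real N) ^ m * (real (n choose m) * beta N n Z ^ (n - m))"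
proof -
  let ?\<S> = "{S \<in> Pow {1..n}. card S = m}"
  let ?P = "\<lambda>S. rperm {1..N} S (acoef N Z)"
  define lam where "lam k = (\<Sum>j\<in>{1..N}. (norm (acoef N Z j k))\<^sup>2)" for k
  define F where "F = (\<Sum>k\<in>{1..n}. lam k)"
  define K where "K = (fact m)\<^sup>2 * (exp (real m) * fact N / (fact (N - m) * real N ^ m * real m ^ m))"
  have K: "K \<ge> 0" by (simp add: K_def)
  have lam: "lam k \<ge> 0" for k unfolding lam_def by (intro sum_nonneg) auto
  have F_eq: "real n * alpha N n Z / real N = F / (real N)\<^sup>2"
  proof -
    have "(\<Sum>j\<in>{1..N}. \<Sum>k\<in>{1..n}. (norm (acoef N Z j k))\<^sup>2) = F"
      unfolding F_def lam_def by (rule sum.swap)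
    then show ?thesis using assms by (simp add: alpha_def power2_eq_square)
  qed
  have permanents: "(\<Sum>S\<in>?\<S>. (norm (?P S))\<^sup>2) \<le> K * (real (N choose m) * (F / real N) ^ m)"
  proof -
    have "(norm (?P S))\<^sup>2 \<le> K * (\<Prod>k\<in>S. lam k)" if S: "S \<in> ?\<S>" for S
    proof -
      have "finite S" "S \<noteq> {}" using S assms finite_subset[of S "{1..n}"] by auto
      then show ?thesis
        using norm_rperm_centered_le[of "{1..N}" S "acoef N Z"] S assms sum_acoef
        by (simp add: K_def lam_def)
    qed
    then have "(\<Sum>S\<in>?\<S>. (norm (?P S))\<^sup>2) \<le> (\<Sum>S\<in>?\<S>. K * (\<Prod>k\<in>S. lam k))"
      by (rule sum_mono)
    also have "\<dots> = K * esym {1..n} m lam" by (simp add: esym_def sum_distrib_left)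
    also have "\<dots> \<le> K * (real (N choose m) * (F / real N) ^ m)"
    proof (rule mult_left_mono[OF _ K])
      \<comment> \<open>Padding with zeros to \<open>N\<close> variables replaces \<open>binom(n, m) / n\<^sup>m\<close> by \<open>binom(N, m) / N\<^sup>m\<close>, which the prefactor cancels exactly.\<close>
      define lam' where "lam' k = (if k \<in> {1..n} then lam k else 0)" for k
      have "esym {1..n} m lam = esym {1..n} m lam'"
        unfolding esym_def by (intro sum.cong prod.cong refl) (auto simp: lam'_def)
      also have "\<dots> \<le> esym {1..N} m lam'"
        by (rule esym_mono_set) (use assms lam in \<open>auto simp: lam'_def\<close>)
      also have "\<dots> \<le> real (N choose m) * ((\<Sum>k\<in>{1..N}. lam' k) / real N) ^ m"
        using maclaurin_esym[of "{1..N}" lam' m] lam by (simp add: lam'_def)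
      also have "(\<Sum>k\<in>{1..N}. lam' k) = F"
      proof -
        have "(\<Sum>k\<in>{1..N}. lam' k) = (\<Sum>k\<in>{1..n}. lam k)"
          by (rule sum.mono_neutral_cong_right) (use assms in \<open>auto simp: lam'_def\<close>)
        then show ?thesis by (simp add: F_def)
      qed
      finally show "esym {1..n} m lam \<le> real (N choose m) * (F / real N) ^ m" .
    qed
    finally show ?thesis .
  qed
  have means: "(\<Sum>S\<in>?\<S>. (\<Prod>k\<in>{1..n} - S. norm (zbar N Z k))\<^sup>2) \<le> real (n choose m) * beta N n Z ^ (n - m)"
  proof -
    have "(\<Sum>S\<in>?\<S>. (\<Prod>k\<in>{1..n} - S. norm (zbar N Z k))\<^sup>2) = esym {1..n} (n - m) (\<lambda>k. (norm (zbar N Z k))\<^sup>2)"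
      unfolding esym_def
    proof (rule sum.reindex_bij_witness[of _ "\<lambda>T. {1..n} - T" "\<lambda>S. {1..n} - S"], goal_cases)
      case (2 S)
      then show ?case
        using card_Diff_subset[of S "{1..n}"] finite_subset[of S "{1..n}"] by auto
    next
      case (4 T)
      then show ?case
        using card_Diff_subset[of T "{1..n}"] finite_subset[of T "{1..n}"] assms by auto
    qed (auto simp: prod_power_distrib)
    also have "\<dots> \<le> real (n choose (n - m)) * beta N n Z ^ (n - m)"
      using maclaurin_esym[of "{1..n}" "\<lambda>k. (norm (zbar N Z k))\<^sup>2" "n - m"] by (simp add: beta_def)
    finally show ?thesis using assms by (simp add: binomial_symmetric[symmetric])
  qed
  have "norm (G N n Z m) \<le> fact (N - m) / fact N *
      (\<Sum>S\<in>?\<S>. norm (?P S) * (\<Prod>k\<in>{1..n} - S. norm (zbar N Z k)))"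
  proof -
    have "norm (\<Sum>S\<in>?\<S>. ?P S * (\<Prod>k\<in>{1..n} - S. zbar N Z k))
        \<le> (\<Sum>S\<in>?\<S>. norm (?P S * (\<Prod>k\<in>{1..n} - S. zbar N Z k)))"
      by (rule norm_sum)
    also have "\<dots> = (\<Sum>S\<in>?\<S>. norm (?P S) * (\<Prod>k\<in>{1..n} - S. norm (zbar N Z k)))"
      by (simp only: norm_mult prod_norm)
    finally show ?thesis
      unfolding G_eq[OF assms(2)] norm_mult norm_divide norm_fact by (rule mult_left_mono) simp
  qed
  then have "(norm (G N n Z m))\<^sup>2 \<le> (fact (N - m) / fact N)\<^sup>2 *
      (\<Sum>S\<in>?\<S>. norm (?P S) * (\<Prod>k\<in>{1..n} - S. norm (zbar N Z k)))\<^sup>2"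
    unfolding power_mult_distrib[symmetric] by (rule power_mono) auto
  also have "\<dots> \<le> (fact (N - m) / fact N)\<^sup>2 *
      ((\<Sum>S\<in>?\<S>. (norm (?P S))\<^sup>2) * (\<Sum>S\<in>?\<S>. (\<Prod>k\<in>{1..n} - S. norm (zbar N Z k))\<^sup>2))"
    by (intro mult_left_mono Cauchy_Schwarz_ineq_sum) auto
  also have "\<dots> \<le> (fact (N - m) / fact N)\<^sup>2 *
      ((K * (real (N choose m) * (F / real N) ^ m)) * (real (n choose m) * beta N n Z ^ (n - m)))"
  proof (rule mult_left_mono[OF mult_mono[OF permanents means]])
    show "0 \<le> K * (real (N choose m) * (F / real N) ^ m)"
      by (rule order_trans[OF sum_nonneg permanents]) simp
    show "0 \<le> (\<Sum>S\<in>?\<S>. (\<Prod>k\<in>{1..n} - S. norm (zbar N Z k))\<^sup>2)"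
      by (rule sum_nonneg) simp
  qed simp
  also have "\<dots> = exp (real m) * fact m / real m ^ m *
    (F / (real N)\<^sup>2) ^ m * (real (n choose m) * beta N n Z ^ (n - m))"
  proof -
    have cancel: "(a / b)\<^sup>2 * (f\<^sup>2 * (e * b / (a * p * q)) * (b / (f * a) * (g / p))) = e * f / q * (g / p\<^sup>2)"
      if "a > 0" "b > 0" "f > 0" "p > 0" "q > 0" for a b e f g p q :: real
      using that by (simp add: field_simps power2_eq_square)
    have "real (N choose m) = fact N / (fact m * fact (N - m))"
      using assms binomial_fact[of m N, where 'a = real] by simp
    then have "(fact (N - m) / fact N)\<^sup>2 * (K * (real (N choose m) * (F / real N) ^ m))
        = exp (real m) * fact m / real m ^ m * (F / (real N)\<^sup>2) ^ m"
      using cancel[of "fact (N - m)" "fact N" "fact m" "real N ^ m" "real m ^ m" "exp (real m)" "F ^ m"] assms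
      unfolding K_def power_divide power_mult[symmetric] mult.commute[of 2] by (simp add: power_mult)
    then show ?thesis by (simp only: mult.assoc[symmetric])
  qed
  finally show ?thesis unfolding F_eq .
qed

section \<open>Sums of consecutive terms\<close>

text \<open>
  The constant \<open>C r\<close> is designed such that \<open>r\<^sup>1\<^sup>/\<^sup>4 C r\<close> is the square root of \<open>e\<^sup>r r! / r\<^sup>r\<close>, the factor
  in the bound for \<open>G\<^sub>r\<close>.
\<close>
lemma C_square: "r \<ge> 1 \<Longrightarrow> (C r)\<^sup>2 * sqrt (real r) = exp (real r) * fact r / real r ^ r"
proof -
  assume r: "r \<ge> 1"
  have "(C r)\<^sup>2 = exp (real r) * fact r / real r powr (real r + 1 / 2)"
    unfolding C_def by (rule real_sqrt_pow2) simp
  also have "real r powr (real r + 1 / 2) = real r ^ r * sqrt (real r)"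
    using r by (simp add: powr_add powr_realpow powr_half_sqrt)
  finally show ?thesis using r by simp
qed

lemma C_pos: "r \<ge> 1 \<Longrightarrow> C r > 0"
  unfolding C_def by simp

text \<open>
  The function \<open>ln (1 + t) - 2 t / (2 + t)\<close> vanishes at \<open>0\<close> and has the derivative
  \<open>t\<^sup>2 / ((1 + t) (2 + t)\<^sup>2)\<close>.
\<close>
lemma ln_one_plus_inverse_ge:
  assumes "n \<ge> 1"
  shows "1 \<le> (real n + 1 / 2) * ln (1 + 1 / real n)"
proof -
  define f where "f t = ln (1 + t) - 2 * t / (2 + t)" for t :: real
  have "f 0 \<le> f (1 / real n)"
  proof (rule DERIV_nonneg_imp_nondecreasing[of 0 "1 / real n" f])
    fix t :: real assume t: "0 \<le> t" "t \<le> 1 / real n"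
    have "(f has_real_derivative (1 / (1 + t) - (2 * (2 + t) - 2 * t) / (2 + t)\<^sup>2)) (at t)"
      unfolding f_def using t by (auto intro!: derivative_eq_intros simp: power2_eq_square)
    moreover have "1 / (1 + t) - (2 * (2 + t) - 2 * t) / (2 + t)\<^sup>2 = t\<^sup>2 / ((1 + t) * (2 + t)\<^sup>2)"
      using t by (simp add: divide_simps) (simp add: power2_eq_square algebra_simps)
    ultimately show "\<exists>y. (f has_real_derivative y) (at t) \<and> 0 \<le> y"
      using t by (intro exI[of _ "t\<^sup>2 / ((1 + t) * (2 + t)\<^sup>2)"]) simp
  qed simp
  then have "2 * (1 / real n) / (2 + 1 / real n) \<le> ln (1 + 1 / real n)"
    by (simp add: f_def)
  moreover have "2 * (1 / real n) / (2 + 1 / real n) * (real n + 1 / 2) = 1"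
    using assms by (simp add: field_simps)
  ultimately show ?thesis
    using mult_right_mono[of "2 * (1 / real n) / (2 + 1 / real n)" "ln (1 + 1 / real n)" "real n + 1 / 2"]
    by (simp add: mult.commute)
qed

text \<open>
  The quotient of the squares is \<open>e (1 + 1/r)\<^sup>-\<^sup>r\<^sup>-\<^sup>1\<^sup>/\<^sup>2\<close>; the estimate of the logarithm
  says that it is at most \<open>1\<close>.
\<close>
lemma C_Suc_le:
  assumes "r \<ge> 1"
  shows "C (Suc r) \<le> C r"
proof -
  have "exp (real (Suc r)) * fact (Suc r) / real (Suc r) powr (real (Suc r) + 1 / 2)
      \<le> exp (real r) * fact r / real r powr (real r + 1 / 2)"
  proof -
    have "exp 1 \<le> exp ((real r + 1 / 2) * ln (1 + 1 / real r))"
      using ln_one_plus_inverse_ge[OF assms] by simp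
    also have "\<dots> = (1 + 1 / real r) powr (real r + 1 / 2)"
      using add_pos_nonneg[of 1 "1 / real r"] by (simp add: powr_def)
    also have "1 + 1 / real r = real (Suc r) / real r" using assms by (simp add: field_simps)
    also have "(real (Suc r) / real r) powr (real r + 1 / 2) =
        real (Suc r) powr (real r + 1 / 2) / real r powr (real r + 1 / 2)"
      by (rule powr_divide)
    finally have le: "exp 1 * real r powr (real r + 1 / 2) \<le> real (Suc r) powr (real r + 1 / 2)"
      using assms by (simp add: field_simps)
    have "real (Suc r) powr (real (Suc r) + 1 / 2) = real (Suc r) powr (1 + (real r + 1 / 2))"
      by simp
    also have "\<dots> = real (Suc r) * real (Suc r) powr (real r + 1 / 2)"
      by (subst powr_add) simp
    finally have eq: "real (Suc r) powr (real (Suc r) + 1 / 2) = real (Suc r) * real (Suc r) powr (real r + 1 / 2)" .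
    have "exp (real (Suc r)) = exp (real r) * exp 1" by (simp add: exp_add[symmetric] add.commute)
    then have "exp (real (Suc r)) * fact (Suc r) * real r powr (real r + 1 / 2)
        = exp (real r) * fact r * (real (Suc r) * (exp 1 * real r powr (real r + 1 / 2)))"
      by (simp add: mult_ac)
    also have "\<dots> \<le> exp (real r) * fact r * (real (Suc r) * real (Suc r) powr (real r + 1 / 2))"
      using le by (intro mult_left_mono) auto
    also have "\<dots> = exp (real r) * fact r * real (Suc r) powr (real (Suc r) + 1 / 2)"
      unfolding eq ..
    finally show ?thesis
      using assms by (simp add: divide_le_eq le_divide_eq del: fact_Suc of_nat_Suc)
  qed
  then show ?thesis unfolding C_def by (rule real_sqrt_le_mono)
qed

lemma C_antimono:
  assumes "1 \<le> p" "p \<le> m"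
  shows "C m \<le> C p"
  using assms(2)
proof (induction m rule: dec_induct)
  case (step m)
  then show ?case using C_Suc_le[of m] assms(1) by simp
qed simp

lemma norm_zbar_le:
  assumes "N \<ge> 1" "\<And>j. j \<in> {1..N} \<Longrightarrow> cmod (Z j k) \<le> 1"
  shows "cmod (zbar N Z k) \<le> 1"
proof -
  have "norm (\<Sum>j\<in>{1..N}. Z j k) \<le> (\<Sum>j\<in>{1..N}. 1)"
    by (rule order_trans[OF norm_sum sum_mono]) (use assms in auto)
  then show ?thesis using assms(1) by (simp add: zbar_def norm_mult norm_divide)
qed

text \<open>
  The mixed terms of \<open>|z - b|\<^sup>2\<close> add up to \<open>-2 N |b|\<^sup>2\<close> if \<open>b\<close> is the mean of the \<open>N\<close> values of \<open>z\<close>.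
\<close>
lemma sum_norm_acoef:
  assumes "N \<ge> 1"
  shows "(\<Sum>j\<in>{1..N}. (cmod (acoef N Z j k))\<^sup>2) =
    (\<Sum>j\<in>{1..N}. (cmod (Z j k))\<^sup>2) - real N * (cmod (zbar N Z k))\<^sup>2"
proof -
  define b where "b = zbar N Z k"
  have b: "(\<Sum>j\<in>{1..N}. Z j k) = of_nat N * b"
    using assms by (simp add: b_def zbar_def)
  have "(cmod (z - b))\<^sup>2 = (cmod z)\<^sup>2 + (cmod b)\<^sup>2 - 2 * Re (z * cnj b)" for z
    unfolding cmod_power2 by (simp add: power2_eq_square algebra_simps)
  then have "(\<Sum>j\<in>{1..N}. (cmod (acoef N Z j k))\<^sup>2) =
      (\<Sum>j\<in>{1..N}. (cmod (Z j k))\<^sup>2) + real N * (cmod b)\<^sup>2 - 2 * Re ((\<Sum>j\<in>{1..N}. Z j k) * cnj b)"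
    unfolding acoef_def b_def[symmetric] sum_distrib_right Re_sum
    by (simp add: sum.distrib sum_subtractf sum_distrib_left)
  also have "Re ((\<Sum>j\<in>{1..N}. Z j k) * cnj b) = real N * (cmod b)\<^sup>2"
    unfolding b mult.assoc complex_norm_square[symmetric] by simp
  finally show ?thesis by (simp add: b_def)
qed

lemma alpha_nonneg: "alpha N n Z \<ge> 0"
  unfolding alpha_def by (intro mult_nonneg_nonneg sum_nonneg) auto

lemma beta_nonneg: "beta N n Z \<ge> 0"
  unfolding beta_def by (intro mult_nonneg_nonneg sum_nonneg) auto

lemma alpha_plus_beta_le:
  assumes "N \<ge> 1" "n \<ge> 1" "\<And>j k. j \<in> {1..N} \<Longrightarrow> k \<in> {1..n} \<Longrightarrow> cmod (Z j k) \<le> 1"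
  shows "alpha N n Z + beta N n Z \<le> 1"
proof -
  have "(\<Sum>j\<in>{1..N}. \<Sum>k\<in>{1..n}. (cmod (acoef N Z j k))\<^sup>2) =
      (\<Sum>k\<in>{1..n}. (\<Sum>j\<in>{1..N}. (cmod (Z j k))\<^sup>2) - real N * (cmod (zbar N Z k))\<^sup>2)"
    by (subst sum.swap) (simp only: sum_norm_acoef[OF assms(1)])
  also have "\<dots> = (\<Sum>k\<in>{1..n}. \<Sum>j\<in>{1..N}. (cmod (Z j k))\<^sup>2) - real N * (\<Sum>k\<in>{1..n}. (cmod (zbar N Z k))\<^sup>2)"
    by (simp add: sum_subtractf sum_distrib_left)
  also have "(\<Sum>k\<in>{1..n}. (cmod (zbar N Z k))\<^sup>2) = real n * beta N n Z"
    using assms by (simp add: beta_def)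
  also have "(\<Sum>k\<in>{1..n}. \<Sum>j\<in>{1..N}. (cmod (Z j k))\<^sup>2) \<le> (\<Sum>k\<in>{1..n}. \<Sum>j\<in>{1..N}. 1)"
    using assms(3) by (intro sum_mono) (simp add: power_le_one)
  finally have "(\<Sum>j\<in>{1..N}. \<Sum>k\<in>{1..n}. (cmod (acoef N Z j k))\<^sup>2) \<le> real n * real N * (1 - beta N n Z)"
    by (simp add: algebra_simps)
  then have "alpha N n Z \<le> 1 - beta N n Z"
    using assms by (simp add: alpha_def divide_le_eq mult.commute)
  then show ?thesis by simp
qed

lemma gamma_nonneg:
  assumes "N \<ge> 1" "n \<ge> 1" "\<And>j k. j \<in> {1..N} \<Longrightarrow> k \<in> {1..n} \<Longrightarrow> cmod (Z j k) \<le> 1"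
  shows "gamma N n Z \<ge> 0"
proof -
  have "beta N n Z \<le> 1"
    using alpha_plus_beta_le[of N n Z] assms alpha_nonneg[of N n Z] by simp
  then show ?thesis
    unfolding gamma_def using alpha_nonneg[of N n Z] by (intro mult_nonneg_nonneg) auto
qed

lemma gamma_le_1:
  assumes "n \<ge> 1" "n \<le> N" "\<And>j k. j \<in> {1..N} \<Longrightarrow> k \<in> {1..n} \<Longrightarrow> cmod (Z j k) \<le> 1"
  shows "gamma N n Z \<le> 1"
proof -
  have le: "alpha N n Z \<le> 1 - beta N n Z"
    using alpha_plus_beta_le[of N n Z] assms by simp
  show ?thesis
  proof (cases "beta N n Z = 1")
    case True
    then have "alpha N n Z = 0" using le alpha_nonneg[of N n Z] by simp
    then show ?thesis by (simp add: gamma_def)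
  next
    case False
    then have pos: "1 - beta N n Z > 0" using le alpha_nonneg[of N n Z] by simp
    have "gamma N n Z \<le> real n * alpha N n Z / real N * (1 / (1 - beta N n Z))"
      unfolding gamma_def using False alpha_nonneg[of N n Z] by (intro mult_left_mono) auto
    also have "\<dots> = (real n / real N) * (alpha N n Z / (1 - beta N n Z))" by simp
    also have "\<dots> \<le> 1 * 1"
      using assms le pos alpha_nonneg[of N n Z] by (intro mult_mono) auto
    finally show ?thesis by simp
  qed
qed

text \<open>
  If \<open>\<theta> = 1 / (1 - b)\<close>, the summands are binomial probabilities. If \<open>\<theta> = n\<close>, the sum is at most
  \<open>(1 + 1/n)\<^sup>n - 2 \<le> e - 2\<close>; for this bound the absence of the terms \<open>m = 0\<close> and \<open>m = 1\<close> is essential.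
\<close>
lemma sum_binomial_weights_le_1:
  fixes b :: real
  assumes "0 \<le> b" "b \<le> 1" "n \<ge> 1"
  defines "\<theta> \<equiv> if b = 1 then real n else min (real n) (1 / (1 - b))"
  shows "(\<Sum>m\<in>{2..n}. real (n choose m) * b ^ (n - m) / \<theta> ^ m) \<le> 1"
proof (cases "b < 1 \<and> 1 / (1 - b) \<le> real n")
  case True
  then have \<theta>: "\<theta> = 1 / (1 - b)" by (simp add: \<theta>_def min_def)
  have "(\<Sum>m\<in>{2..n}. real (n choose m) * b ^ (n - m) / \<theta> ^ m) \<le>
      (\<Sum>m\<le>n. real (n choose m) * (1 - b) ^ m * b ^ (n - m))"
    using assms True by (simp add: \<theta> power_divide mult_ac) (intro sum_mono2; auto)
  also have "\<dots> = ((1 - b) + b) ^ n" by (rule binomial_ring[symmetric])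
  finally show ?thesis by simp
next
  case False
  then have \<theta>: "\<theta> = real n" using assms by (auto simp: \<theta>_def)
  show ?thesis
  proof (cases "n = 1")
    case False
    then have n: "n \<ge> 2" using assms by simp
    have "(\<Sum>m\<in>{2..n}. real (n choose m) * b ^ (n - m) / \<theta> ^ m) \<le>
        (\<Sum>m\<in>{2..n}. real (n choose m) * (1 / real n) ^ m)"
    proof (intro sum_mono)
      fix m
      have "real (n choose m) * b ^ (n - m) \<le> real (n choose m) * 1"
        using assms by (intro mult_left_mono power_le_one) auto
      then show "real (n choose m) * b ^ (n - m) / \<theta> ^ m \<le> real (n choose m) * (1 / real n) ^ m"
        by (simp add: \<theta> power_divide divide_right_mono)
    qed
    also have "\<dots> = (\<Sum>m\<le>n. real (n choose m) * (1 / real n) ^ m) - 2"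
    proof -
      have "{..n} = insert 0 (insert 1 {2..n})" using n by auto
      then show ?thesis using n by simp
    qed
    also have "(\<Sum>m\<le>n. real (n choose m) * (1 / real n) ^ m) = (1 / real n + 1) ^ n"
      using binomial_ring[of "1 / real n" 1 n] by simp
    also have "\<dots> \<le> exp (1 / real n) ^ n"
      using exp_ge_add_one_self[of "1 / real n"] by (intro power_mono) (simp_all add: add.commute)
    also have "\<dots> = exp 1" using n by (simp add: exp_of_nat_mult[symmetric])
    also have "exp 1 \<le> (3::real)" by (rule exp_le)
    finally show ?thesis by simp
  qed simp
qed

text \<open>
  The geometric sum satisfies \<open>S\<^sub>r\<^sub>+\<^sub>1 = 1 + g S\<^sub>r\<close> and the left side satisfies
  \<open>f\<^sub>r\<^sub>+\<^sub>1 = S\<^sub>r\<^sub>+\<^sub>1 + g f\<^sub>r\<close>, so \<open>f\<^sub>r \<le> S\<^sub>r\<^sup>2 \<le> S\<^sub>r S\<^sub>r\<^sub>+\<^sub>1\<close> leads to \<open>f\<^sub>r\<^sub>+\<^sub>1 \<le> S\<^sub>r\<^sub>+\<^sub>1 (1 + g S\<^sub>r)\<close>.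
\<close>
lemma sum_Suc_power_le:
  fixes g :: real
  assumes "g \<ge> 0"
  shows "(\<Sum>j<r. real (Suc j) * g ^ j) \<le> (\<Sum>j<r. g ^ j)\<^sup>2"
proof (induction r)
  case (Suc r)
  let ?S = "\<lambda>r. \<Sum>j<r. g ^ j"
  have S_Suc: "?S (Suc r) = 1 + g * ?S r"
    by (simp add: sum.lessThan_Suc_shift sum_distrib_left del: sum.lessThan_Suc)
  have S0: "?S r \<ge> 0" using assms by (intro sum_nonneg) auto
  have "(\<Sum>j<Suc r. real (Suc j) * g ^ j) = ?S (Suc r) + g * (\<Sum>j<r. real (Suc j) * g ^ j)"
    by (simp add: sum.lessThan_Suc_shift sum_distrib_left sum.distrib algebra_simps del: sum.lessThan_Suc)
  also have "\<dots> \<le> ?S (Suc r) + g * (?S r)\<^sup>2"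
    using Suc assms by (intro add_left_mono mult_left_mono) auto
  also have "\<dots> \<le> ?S (Suc r) + g * (?S r * ?S (Suc r))"
    using assms S0 by (intro add_left_mono mult_left_mono) (auto simp: power2_eq_square intro!: mult_left_mono)
  also have "\<dots> = (?S (Suc r))\<^sup>2"
    unfolding S_Suc by (simp add: power2_eq_square algebra_simps)
  finally show ?case .
qed simp

text \<open>
  Let \<open>X\<close> be the left side. Cauchy-Schwarz against the weights with sum at most \<open>1\<close> gives
  \<open>X\<^sup>2 \<le> C\<^sub>p\<^sup>2 T\<close> with \<open>T = \<Sum>\<^sub>m m\<^sup>1\<^sup>/\<^sup>2 g\<^sup>m\<close>, and once more \<open>T\<^sup>2 \<le> (\<Sum>\<^sub>m g\<^sup>m) (\<Sum>\<^sub>m m g\<^sup>m) \<le> g\<^sup>p S \<cdot> p g\<^sup>p S\<^sup>2\<close>, where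
  \<open>S\<close> is the geometric sum with \<open>r\<close> terms. The exponent \<open>3/4\<close> comes from the fourth root of \<open>S\<^sup>3\<close>.
\<close>
lemma sum_G_le:
  assumes "2 \<le> p" "p + r \<le> Suc n" "n \<le> N"
    and Z: "\<And>j k. j \<in> {1..N} \<Longrightarrow> k \<in> {1..n} \<Longrightarrow> cmod (Z j k) \<le> 1"
  shows "(\<Sum>m\<in>{p..<p + r}. cmod (G N n Z m)) \<le>
    real p powr (1 / 4) * C p * (gamma N n Z powr (real p / 2) *
      (\<Sum>j<r. gamma N n Z ^ j) powr (3 / 4))"
proof (cases "r = 0")
  case False
  let ?M = "{p..<p + r}"
  define a where "a = real n * alpha N n Z / real N"
  define b where "b = beta N n Z"
  define g where "g = gamma N n Z"
  define \<theta> where "\<theta> = (if b = 1 then real n else min (real n) (1 / (1 - b)))"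
  define S where "S = (\<Sum>j<r. g ^ j)"
  define v where "v m = real (n choose m) * b ^ (n - m) / \<theta> ^ m" for m
  have n: "n \<ge> 1" using assms False by simp
  have b: "0 \<le> b" "b \<le> 1"
    using alpha_plus_beta_le[of N n Z] alpha_nonneg[of N n Z] n assms by (simp_all add: b_def beta_nonneg)
  have \<theta>: "\<theta> > 0" using b n by (auto simp: \<theta>_def)
  have g0: "g \<ge> 0" using gamma_nonneg[of N n Z] n assms by (simp add: g_def)
  have g_eq: "g = a * \<theta>" by (simp add: g_def gamma_def a_def \<theta>_def b_def)
  have v0: "v m \<ge> 0" for m using b \<theta> by (simp add: v_def)
  have S0: "S \<ge> 0" using g0 unfolding S_def by (intro sum_nonneg) auto
  have v_sum: "(\<Sum>m\<in>?M. v m) \<le> 1"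
  proof -
    have "(\<Sum>m\<in>?M. v m) \<le> (\<Sum>m\<in>{2..n}. v m)"
      by (rule sum_mono2) (use assms v0 in auto)
    then show ?thesis using sum_binomial_weights_le_1[OF b n] by (simp add: v_def \<theta>_def)
  qed
  have G_sq: "cmod (G N n Z m) \<le> C p * sqrt (sqrt (real m) * g ^ m) * sqrt (v m)" if m: "m \<in> ?M" for m
  proof -
    have "(cmod (G N n Z m))\<^sup>2 \<le> (C m)\<^sup>2 * sqrt (real m) * a ^ m * (real (n choose m) * b ^ (n - m))"
      using norm_G_le[of m n N Z] m assms C_square[of m] by (simp add: a_def b_def)
    also have "\<dots> = (C m)\<^sup>2 * (sqrt (real m) * g ^ m * v m)"
      using \<theta> by (simp add: g_eq v_def power_mult_distrib)
    also have "\<dots> \<le> (C p)\<^sup>2 * (sqrt (real m) * g ^ m * v m)"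
      using C_antimono[of p m] C_pos[of m] m assms g0 v0 by (intro mult_right_mono power_mono) auto
    finally have "(cmod (G N n Z m))\<^sup>2 \<le> (C p)\<^sup>2 * (sqrt (real m) * g ^ m * v m)" .
    then have "cmod (G N n Z m) \<le> sqrt ((C p)\<^sup>2 * (sqrt (real m) * g ^ m * v m))"
      by (rule real_le_rsqrt)
    then show ?thesis using C_pos[of p] assms by (simp add: real_sqrt_mult)
  qed
  define X where "X = (\<Sum>m\<in>?M. cmod (G N n Z m))"
  define T where "T = (\<Sum>m\<in>?M. sqrt (real m) * g ^ m)"
  have X0: "X \<ge> 0" unfolding X_def by (intro sum_nonneg) auto
  have T0: "T \<ge> 0" unfolding T_def using g0 by (intro sum_nonneg) auto
  have "X \<le> C p * (\<Sum>m\<in>?M. sqrt (sqrt (real m) * g ^ m) * sqrt (v m))"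
    unfolding X_def sum_distrib_left using G_sq by (intro sum_mono) (simp add: mult.assoc)
  then have "X\<^sup>2 \<le> (C p * (\<Sum>m\<in>?M. sqrt (sqrt (real m) * g ^ m) * sqrt (v m)))\<^sup>2"
    using X0 by (intro power_mono)
  also have "\<dots> \<le> (C p)\<^sup>2 * ((\<Sum>m\<in>?M. (sqrt (sqrt (real m) * g ^ m))\<^sup>2) * (\<Sum>m\<in>?M. (sqrt (v m))\<^sup>2))"
    unfolding power_mult_distrib by (intro mult_left_mono Cauchy_Schwarz_ineq_sum) simp
  also have "\<dots> = (C p)\<^sup>2 * (T * (\<Sum>m\<in>?M. v m))"
    using g0 v0 by (simp add: T_def)
  also have "\<dots> \<le> (C p)\<^sup>2 * (T * 1)"
    using v_sum T0 by (intro mult_left_mono) auto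
  finally have X2: "X\<^sup>2 \<le> (C p)\<^sup>2 * T" by simp
  have shift: "(\<Sum>m\<in>?M. f m) = (\<Sum>j<r. f (p + j))" for f :: "nat \<Rightarrow> real"
    using sum.shift_bounds_nat_ivl[of f 0 p r] by (simp add: lessThan_atLeast0 add.commute)
  have "T\<^sup>2 = (\<Sum>m\<in>?M. sqrt (g ^ m) * sqrt (real m * g ^ m))\<^sup>2"
    using g0 by (simp add: T_def real_sqrt_mult mult_ac)
  also have "\<dots> \<le> (\<Sum>m\<in>?M. (sqrt (g ^ m))\<^sup>2) * (\<Sum>m\<in>?M. (sqrt (real m * g ^ m))\<^sup>2)"
    by (rule Cauchy_Schwarz_ineq_sum)
  also have "\<dots> = (\<Sum>m\<in>?M. g ^ m) * (\<Sum>m\<in>?M. real m * g ^ m)"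
    using g0 by simp
  also have "\<dots> \<le> (g ^ p * S) * (real p * g ^ p * S\<^sup>2)"
  proof (intro mult_mono)
    show "(\<Sum>m\<in>?M. g ^ m) \<le> g ^ p * S"
      by (simp add: shift S_def power_add sum_distrib_left)
    have "(\<Sum>m\<in>?M. real m * g ^ m) \<le> (\<Sum>j<r. real p * g ^ p * (real (Suc j) * g ^ j))"
      unfolding shift
    proof (intro sum_mono)
      fix j
      have "real (p + j) \<le> real (p * Suc j)"
        unfolding of_nat_le_iff using assms(1) by simp
      then have "real (p + j) * (g ^ p * g ^ j) \<le> real (p * Suc j) * (g ^ p * g ^ j)"
        using g0 by (intro mult_right_mono) auto
      then show "real (p + j) * g ^ (p + j) \<le> real p * g ^ p * (real (Suc j) * g ^ j)"
        by (simp add: power_add algebra_simps)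
    qed
    also have "\<dots> = real p * g ^ p * (\<Sum>j<r. real (Suc j) * g ^ j)"
      by (simp only: sum_distrib_left)
    also have "\<dots> \<le> real p * g ^ p * S\<^sup>2"
      unfolding S_def using sum_Suc_power_le[OF g0] g0 by (intro mult_left_mono) auto
    finally show "(\<Sum>m\<in>?M. real m * g ^ m) \<le> real p * g ^ p * S\<^sup>2" .
  qed (use g0 S0 in \<open>auto intro!: sum_nonneg\<close>)
  finally have T2: "T\<^sup>2 \<le> real p * (g ^ p)\<^sup>2 * S ^ 3"
    by (simp add: power2_eq_square power3_eq_cube mult_ac)
  define R where "R = real p powr (1 / 4) * C p * (g powr (real p / 2) * S powr (3 / 4))"
  have "X ^ 4 = (X\<^sup>2)\<^sup>2" by simp
  also have "\<dots> \<le> ((C p)\<^sup>2 * T)\<^sup>2" using X2 by (rule power_mono) simp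
  also have "\<dots> = (C p) ^ 4 * T\<^sup>2" by (simp add: power_mult_distrib)
  also have "\<dots> \<le> (C p) ^ 4 * (real p * (g ^ p)\<^sup>2 * S ^ 3)" using T2 by (intro mult_left_mono) auto
  also have "\<dots> = R ^ 4"
  proof -
    have "(real p powr (1 / 4)) ^ 4 = real p" using assms by (simp add: powr_power)
    moreover have "(S powr (3 / 4)) ^ 4 = S ^ 3"
      using S0 by (cases "S = 0") (simp_all add: powr_power)
    moreover have "(g powr (real p / 2)) ^ 4 = (g ^ p)\<^sup>2"
    proof (cases "g = 0")
      case False
      then have "(g powr (real p / 2)) ^ 4 = g powr real (2 * p)"
        using g0 by (simp add: powr_power)
      also have "\<dots> = g ^ (2 * p)" using False g0 by (intro powr_realpow) auto
      finally show ?thesis by (simp add: power_mult mult.commute)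
    qed (use assms in simp)
    ultimately show ?thesis by (simp add: R_def power_mult_distrib)
  qed
  finally have "X \<le> R"
    by (rule power_le_imp_le_base[of X 3 R, simplified]) (use C_pos[of p] assms in \<open>simp add: R_def\<close>)
  then show ?thesis by (simp add: X_def R_def S_def g_def)
qed simp

section \<open>The equation for the optimal threshold\<close>

text \<open>
  The right side of the equation for \<open>x\<^sub>l\<close>, divided by \<open>x\<^sup>(\<^sup>l\<^sup>+\<^sup>1\<^sup>)\<^sup>/\<^sup>2\<close>; it controls the error for small \<open>\<gamma>\<close>.
\<close>
definition tail_factor :: "nat \<Rightarrow> real \<Rightarrow> real" where
  "tail_factor l x = real (l + 1) powr (1 / 4) * C (l + 1) / (1 - x) powr (3 / 4)"

text \<open>
  The left side of the equation for \<open>x\<^sub>l\<close>, with the quotient written as a geometric sum so that it is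
  meaningful also at \<open>x = 1\<close>, which is a possible value of \<open>\<gamma>\<close>.
\<close>
definition head_bound :: "nat \<Rightarrow> real \<Rightarrow> real" where
  "head_bound l x = 2 + 2 powr (1 / 4) * C 2 * x * (\<Sum>j<l - 1. x ^ j) powr (3 / 4)"

lemma geometric_quotient: "(x::real) \<noteq> 1 \<Longrightarrow> (1 - x ^ r) / (1 - x) = (\<Sum>j<r. x ^ j)"
  using sum_gp_strict[of x r] by simp

text \<open>
  Pairing the first with the last term of the sum, the function \<open>u\<^sup>-\<^sup>k + u\<^sup>k\<close> decreases on \<open>(0, 1]\<close>; the
  terms between them form a shorter sum of the same kind. Hence the induction in steps of two.
\<close>
lemma sum_power_quotient_antimono:
  fixes u v :: real
  assumes "0 < v" "v \<le> u" "u \<le> 1"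
  shows "(\<Sum>j<r. (u\<^sup>2) ^ j) * v ^ r \<le> (\<Sum>j<r. (v\<^sup>2) ^ j) * u ^ r"
proof (induction r rule: induct_nat_012)
  case (ge2 r)
  let ?A = "\<lambda>r u. \<Sum>j<r. (u\<^sup>2) ^ j"
  have split: "?A (Suc (Suc r)) u = (1 + (u ^ Suc r)\<^sup>2) + u\<^sup>2 * ?A r u" for u :: real
  proof -
    have peel: "?A (Suc (Suc r)) u = 1 + u\<^sup>2 * ?A (Suc r) u"
      unfolding sum.lessThan_Suc_shift[of _ "Suc r"] by (simp add: sum_distrib_left del: sum.lessThan_Suc)
    have top: "(u ^ Suc r)\<^sup>2 = u\<^sup>2 * (u\<^sup>2) ^ r"
      by (simp add: power2_eq_square power_mult_distrib)
    show ?thesis unfolding peel top by (simp only: sum.lessThan_Suc distrib_left add_ac)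
  qed
  have uv: "u * v \<le> 1" using assms by (intro mult_le_one) auto
  define U where "U = u ^ Suc r"
  define V where "V = v ^ Suc r"
  have UV: "0 < V" "V \<le> U" "U \<le> 1"
    using assms unfolding U_def V_def by (auto intro!: power_mono power_le_one simp del: power_Suc)
  have "(1 + U\<^sup>2) * V \<le> (1 + V\<^sup>2) * U"
  proof -
    have "0 \<le> (U - V) * (1 - U * V)"
      using UV by (intro mult_nonneg_nonneg) (auto intro: mult_le_one)
    then show ?thesis by (simp add: algebra_simps power2_eq_square)
  qed
  then have "((1 + U\<^sup>2) * V) * v \<le> ((1 + V\<^sup>2) * U) * u"
    by (rule mult_mono) (use assms UV in auto)
  moreover have "(u\<^sup>2 * v\<^sup>2) * (?A r u * v ^ r) \<le> (u\<^sup>2 * v\<^sup>2) * (?A r v * u ^ r)"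
    using ge2(1) by (intro mult_left_mono) auto
  ultimately show ?case
    unfolding split U_def V_def by (simp add: algebra_simps power2_eq_square)
qed (use assms in auto)

text \<open>
  Only the geometric sum needs an argument, as the other factors are powers with a negative exponent.
  The fourth power of the critical quotient is \<open>S(t)\<^sup>3 / t\<^sup>2\<^sup>r\<close> with \<open>r = l - 1\<close>; it decreases because \<open>S(t) / t\<^sup>r\<^sup>/\<^sup>2\<close> does.
\<close>
lemma head_ratio_antimono:
  assumes "0 < s" "s \<le> t" "t \<le> 1" "l \<ge> 1"
  shows "head_bound l t / t powr (real (l + 1) / 2) \<le> head_bound l s / s powr (real (l + 1) / 2)"
proof -
  define r where "r = l - 1"
  have l: "l = Suc r" using assms by (simp add: r_def)
  define S where "S x = (\<Sum>j<r. x ^ j)" for x :: real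
  have S0: "S x \<ge> 0" if "x \<ge> 0" for x unfolding S_def using that by (intro sum_nonneg) auto
  have ratio: "S t powr (3 / 4) * s powr (real r / 2) \<le> S s powr (3 / 4) * t powr (real r / 2)"
  proof -
    define u where "u = sqrt t"
    define v where "v = sqrt s"
    have uv: "0 < v" "v \<le> u" "u \<le> 1" "u\<^sup>2 = t" "v\<^sup>2 = s"
      using assms by (auto simp: u_def v_def)
    have "S t * v ^ r \<le> S s * u ^ r"
      using sum_power_quotient_antimono[OF uv(1-3), of r] by (simp add: uv S_def)
    then have "(S t * v ^ r) ^ 3 \<le> (S s * u ^ r) ^ 3"
      using S0 assms uv by (intro power_mono) auto
    moreover have "v ^ r \<le> u ^ r" using uv by (intro power_mono) auto
    ultimately have cubes: "(S t * v ^ r) ^ 3 * v ^ r \<le> (S s * u ^ r) ^ 3 * u ^ r"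
      using uv S0 assms by (intro mult_mono) auto
    have pow: "(S x powr (3 / 4) * y powr (real r / 2)) ^ 4 = S x ^ 3 * y ^ (2 * r)" if "x > 0" "y > 0" for x y
    proof -
      have "(S x powr (3 / 4)) ^ 4 = S x ^ 3"
        using S0[of x] that by (cases "S x = 0") (simp_all add: powr_power)
      moreover have "(y powr (real r / 2)) ^ 4 = y powr real (2 * r)"
        using that by (simp add: powr_power)
      moreover have "y powr real (2 * r) = y ^ (2 * r)" using that(2) by (rule powr_realpow)
      ultimately show ?thesis by (simp only: power_mult_distrib)
    qed
    have sq: "(y ^ r) ^ 3 * y ^ r = (y\<^sup>2) ^ (2 * r)" for y :: real
      by (simp flip: power_mult power_add)
    have "S t ^ 3 * s ^ (2 * r) \<le> S s ^ 3 * t ^ (2 * r)"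
      using cubes sq[of v] sq[of u] by (simp add: power_mult_distrib mult.assoc uv)
    then have "(S t powr (3 / 4) * s powr (real r / 2)) ^ 4 \<le> (S s powr (3 / 4) * t powr (real r / 2)) ^ 4"
      using assms by (simp add: pow)
    then show ?thesis by (rule power_le_imp_le_base[of _ 3, simplified]) simp
  qed
  have half: "x powr (real (l + 1) / 2) = x * x powr (real r / 2)" if "x > 0" for x :: real
  proof -
    have exponent: "real (l + 1) / 2 = 1 + real r / 2" by (simp add: l field_simps)
    show ?thesis unfolding exponent powr_add using that by simp
  qed
  have form: "head_bound l x / x powr (real (l + 1) / 2) =
      2 / x powr (real (l + 1) / 2) + 2 powr (1 / 4) * C 2 * (S x powr (3 / 4) / x powr (real r / 2))"
    if "x > 0" for x
    using that unfolding half[OF that] by (simp add: head_bound_def S_def r_def field_simps)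
  have "2 / t powr (real (l + 1) / 2) \<le> 2 / s powr (real (l + 1) / 2)"
    using assms by (intro divide_left_mono powr_mono2) auto
  moreover have "S t powr (3 / 4) / t powr (real r / 2) \<le> S s powr (3 / 4) / s powr (real r / 2)"
    using ratio assms by (simp add: field_simps)
  ultimately show ?thesis
    using assms C_pos[of 2] unfolding form[OF assms(1)] form[OF order_less_le_trans[OF assms(1,2)]]
    by (intro add_mono mult_left_mono) auto
qed

lemma solves_eq_iff:
  assumes "0 < x" "x < 1"
  shows "solves_eq l x \<longleftrightarrow> head_bound l x / x powr (real (l + 1) / 2) = tail_factor l x"
proof -
  have quotient: "(1 - x ^ (l - 1)) / (1 - x) = (\<Sum>j<l - 1. x ^ j)"
    using assms by (intro geometric_quotient) simp
  have "h = D * (p / q) \<longleftrightarrow> h / p = D / q" if "p > 0" "q > 0" for h D p q :: real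
    using that by (simp add: field_simps)
  then show ?thesis
    unfolding solves_eq_def quotient head_bound_def[symmetric] tail_factor_def using assms by simp
qed

lemma tail_factor_strict_mono:
  assumes "x < y" "y < 1"
  shows "tail_factor l x < tail_factor l y"
proof -
  have "(1 - y) powr (3 / 4) < (1 - x) powr (3 / 4)"
    using assms by (intro powr_less_mono2) auto
  then show ?thesis
    unfolding tail_factor_def using assms C_pos[of "l + 1"] by (intro divide_strict_left_mono) auto
qed

text \<open>
  The intermediate value theorem applies between the explicit points \<open>x0\<close>, where the right side
  of the equation is at most \<open>1\<close>, and \<open>x1\<close>, so close to \<open>1\<close> that the factor \<open>(1 - x1)\<^sup>-\<^sup>3\<^sup>/\<^sup>4 = B\<close> outweighs a
  bound on the left side over the whole interval.
\<close>
lemma ex_solution: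
  assumes "l \<ge> 1"
  shows "\<exists>x. 0 < x \<and> x < 1 \<and> solves_eq l x"
proof -
  define D where "D = real (l + 1) powr (1 / 4) * C (l + 1)"
  define D2 where "D2 = 2 powr (1 / 4) * C 2"
  define F where "F x = D * x powr (real (l + 1) / 2) / (1 - x) powr (3 / 4) - head_bound l x" for x
  have D: "D > 0" "D2 > 0" using C_pos[of 2] C_pos[of "l + 1"] by (simp_all add: D_def D2_def)
  define x0 where "x0 = 1 / (D + 1)"
  define B where "B = (2 + D2 * real l) * 2 ^ (l + 1) / D + 2"
  define \<delta> where "\<delta> = B powr (-(4 / 3))"
  define x1 where "x1 = 1 - \<delta>"
  have B: "B \<ge> 2" using D by (simp add: B_def)
  have "\<delta> \<le> B powr (-1)" unfolding \<delta>_def using B by (intro powr_mono) auto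
  also have "\<dots> \<le> 1 / 2" using B by (simp add: powr_minus_divide divide_simps)
  finally have \<delta>: "0 < \<delta>" "\<delta> \<le> 1 / 2" using B by (simp_all add: \<delta>_def)
  have x0: "0 < x0" "x0 < 1" using D by (simp_all add: x0_def)
  have x1: "1 / 2 \<le> x1" "x1 < 1" using \<delta> by (simp_all add: x1_def)
  have head_ge: "head_bound l x \<ge> 2" if "x \<ge> 0" for x
    using that D(2) by (simp add: head_bound_def D2_def[symmetric])
  have "F x0 \<le> 0"
  proof -
    have "x0 powr (real (l + 1) / 2) \<le> x0 powr 1"
      using x0 assms by (intro powr_mono') auto
    moreover have "(1 - x0) powr 1 \<le> (1 - x0) powr (3 / 4)"
      using x0 by (intro powr_mono') auto
    ultimately have "D * x0 powr (real (l + 1) / 2) / (1 - x0) powr (3 / 4) \<le> D * x0 / (1 - x0)"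
      using x0 D by (intro frac_le mult_left_mono) auto
    also have "\<dots> = 1" using D by (simp add: x0_def field_simps)
    finally show ?thesis unfolding F_def using head_ge[OF less_imp_le[OF x0(1)]] by linarith
  qed
  moreover have "0 \<le> F x1"
  proof -
    define S where "S = (\<Sum>j<l - 1. x1 ^ j)"
    have "S \<le> (\<Sum>j<l - 1. 1)" unfolding S_def using x1 by (intro sum_mono power_le_one) auto
    then have S: "0 \<le> S" "S \<le> real l" using x1 unfolding S_def by (auto intro!: sum_nonneg)
    have "S powr (3 / 4) \<le> real l powr (3 / 4)" using S by (intro powr_mono2) auto
    also have "\<dots> \<le> real l powr 1" using assms by (intro powr_mono) auto
    finally have "S powr (3 / 4) \<le> real l" using assms by simp
    then have "x1 * S powr (3 / 4) \<le> 1 * real l" using x1 by (intro mult_mono) auto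
    then have "head_bound l x1 \<le> 2 + D2 * real l"
      using D(2) by (simp add: head_bound_def S_def D2_def[symmetric] mult.assoc)
    also have "\<dots> = D * (1 / 2) ^ (l + 1) * (B - 2)"
      using D by (simp add: B_def power_one_over field_simps)
    also have "\<dots> \<le> D * (1 / 2) ^ (l + 1) * B" using D by (intro mult_left_mono) auto
    also have "\<dots> \<le> D * x1 powr (real (l + 1) / 2) * B"
    proof -
      have "(1 / 2 :: real) ^ (l + 1) = (1 / 2) powr real (l + 1)"
        by (rule powr_realpow[symmetric]) simp
      also have "\<dots> \<le> (1 / 2) powr (real (l + 1) / 2)" by (intro powr_mono') auto
      also have "\<dots> \<le> x1 powr (real (l + 1) / 2)" using x1 by (intro powr_mono2) auto
      finally show ?thesis using D B by (intro mult_right_mono mult_left_mono) auto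
    qed
    also have "\<dots> = D * x1 powr (real (l + 1) / 2) / (1 - x1) powr (3 / 4)"
    proof -
      have "(1 - x1) powr (3 / 4) = B powr (-1)" by (simp add: x1_def \<delta>_def powr_powr)
      then show ?thesis using B by (simp add: powr_minus_divide)
    qed
    finally show ?thesis by (simp add: F_def)
  qed
  moreover have cont: "continuous_on {a..b} F" if "0 < a" "b < 1" for a b
    unfolding F_def head_bound_def
    using that
    by (intro continuous_on_add continuous_on_diff continuous_on_divide continuous_on_mult continuous_on_powr'
        continuous_on_sum continuous_on_power continuous_on_const continuous_on_id)
      (auto intro!: sum_nonneg)
  ultimately obtain x where x: "0 < x" "x < 1" "F x = 0"
  proof (cases "x0 \<le> x1")
    case True
    have "\<exists>x\<ge>x0. x \<le> x1 \<and> F x = 0"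
      by (rule IVT'[OF \<open>F x0 \<le> 0\<close> \<open>0 \<le> F x1\<close> True cont[OF x0(1) x1(2)]])
    then obtain x where "x0 \<le> x" "x \<le> x1" "F x = 0" by blast
    then show ?thesis using x0 x1 by (intro that[of x]) auto
  next
    case False
    have "\<exists>x\<ge>x1. x \<le> x0 \<and> F x = 0"
      by (rule IVT2'[of F x0 0 x1, OF \<open>F x0 \<le> 0\<close> \<open>0 \<le> F x1\<close>]) (use False cont[of x1 x0] x0 x1 in auto)
    then obtain x where "x1 \<le> x" "x \<le> x0" "F x = 0" by blast
    then show ?thesis using x0 x1 by (intro that[of x]) auto
  qed
  then have "head_bound l x / x powr (real (l + 1) / 2) = tail_factor l x"
    by (simp add: F_def tail_factor_def D_def field_simps)
  then show ?thesis using solves_eq_iff[OF x(1,2)] x by blast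
qed

text \<open>
  At a solution an antitone function meets a strictly increasing one.
\<close>
lemma ex1_solution:
  assumes "l \<ge> 1"
  shows "\<exists>!x. x \<in> {0<..<1} \<and> solves_eq l x"
proof -
  have no_two: False
    if "x < y" "0 < x" "y < 1" "solves_eq l x" "solves_eq l y" for x y
  proof -
    have "tail_factor l y \<le> tail_factor l x"
      using head_ratio_antimono[of x y l] that assms solves_eq_iff[of x l] solves_eq_iff[of y l] by simp
    then show False using tail_factor_strict_mono[of x y l] that by simp
  qed
  obtain x where x: "0 < x" "x < 1" "solves_eq l x" using ex_solution[OF assms] by blast
  show ?thesis
  proof (rule ex1I[of _ x])
    show "x \<in> {0<..<1} \<and> solves_eq l x" using x by simp
    fix y assume "y \<in> {0<..<1} \<and> solves_eq l y"
    then show "y = x" using x no_two[of x y] no_two[of y x] by (cases x y rule: linorder_cases) auto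
  qed
qed

lemma xsol_props:
  assumes "l \<ge> 1"
  shows "0 < xsol l" "xsol l < 1"
    "head_bound l (xsol l) / xsol l powr (real (l + 1) / 2) = tail_factor l (xsol l)"
proof -
  have *: "xsol l \<in> {0<..<1} \<and> solves_eq l (xsol l)"
    unfolding xsol_def by (rule theI') (rule ex1_solution[OF assms])
  then show "0 < xsol l" "xsol l < 1" by auto
  then show "head_bound l (xsol l) / xsol l powr (real (l + 1) / 2) = tail_factor l (xsol l)"
    using * solves_eq_iff[of "xsol l" l] by blast
qed

text \<open>
  A numerical bound needs no approximation of \<open>xsol l\<close>: at any point \<open>y\<close> the common value at the
  crossing of a decreasing and an increasing function is at most the larger of the two values at \<open>y\<close>.
\<close>
lemma tail_factor_xsol_le:
  assumes "l \<ge> 1" "0 < y" "y < 1"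
    and "head_bound l y / y powr (real (l + 1) / 2) \<le> t" "tail_factor l y \<le> t"
  shows "tail_factor l (xsol l) \<le> t"
proof (cases "y \<le> xsol l")
  case True
  then show ?thesis
    using head_ratio_antimono[of y "xsol l" l] xsol_props[OF assms(1)] assms by simp
next
  case False
  then show ?thesis
    using tail_factor_strict_mono[of "xsol l" y l] assms by simp
qed

section \<open>The error bound and the constant\<close>

lemma G_0: "G N n Z 0 = (\<Prod>k\<in>{1..n}. zbar N Z k)"
proof -
  have "{S \<in> Pow {1..n}. card S = 0} = {{}}" by (auto dest: finite_subset)
  then show ?thesis by (simp add: G_eq)
qed

text \<open>
  The columns of the centered matrix have sum zero.
\<close>
lemma G_1:
  assumes "n \<ge> 1" "n \<le> N"
  shows "G N n Z 1 = 0"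
proof -
  have "rperm {1..N} S (acoef N Z) = 0" if S: "card S = 1" for S
  proof -
    obtain k where k: "S = {k}" using card_1_singletonE[OF S] by blast
    have "rperm {1..N} {k} (acoef N Z) = (\<Sum>j\<in>{1..N}. acoef N Z j k)"
      using rperm_insert_col[of "{1..N}" "{}" k "acoef N Z"] by simp
    then show ?thesis using k sum_acoef[of N Z k] assms by simp
  qed
  then show ?thesis using assms by (simp add: G_eq)
qed

lemma error_le_tail:
  assumes "1 \<le> l" "l \<le> n" "n \<le> N"
    and Z: "\<And>j k. j \<in> {1..N} \<Longrightarrow> k \<in> {1..n} \<Longrightarrow> cmod (Z j k) \<le> 1"
    and g: "gamma N n Z < 1"
  shows "cmod (fact (N - n) / fact N * Per N n Z - H N n Z l) \<le>
    tail_factor l (gamma N n Z) * gamma N n Z powr (real (l + 1) / 2)"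
proof -
  define g where "g = gamma N n Z"
  have g: "0 \<le> g" "g < 1" using gamma_nonneg[of N n Z] assms by (simp_all add: g_def)
  have split: "{..n} = {0..l} \<union> {l + 1..<l + 1 + (n - l)}" using assms by auto
  have "(\<Sum>m\<le>n. G N n Z m) = H N n Z l + (\<Sum>m\<in>{l + 1..<l + 1 + (n - l)}. G N n Z m)"
    unfolding H_def split by (rule sum.union_disjoint) auto
  then have "fact (N - n) / fact N * Per N n Z - H N n Z l =
      (\<Sum>m\<in>{l + 1..<l + 1 + (n - l)}. G N n Z m)"
    unfolding Per_eq_sum_G[OF assms(3)] by simp
  then have "cmod (fact (N - n) / fact N * Per N n Z - H N n Z l) \<le>
      (\<Sum>m\<in>{l + 1..<l + 1 + (n - l)}. cmod (G N n Z m))"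
    by (simp only: norm_sum)
  also have "\<dots> \<le> real (l + 1) powr (1 / 4) * C (l + 1) *
      (g powr (real (l + 1) / 2) * (\<Sum>j<n - l. g ^ j) powr (3 / 4))"
    unfolding g_def by (rule sum_G_le) (use assms in auto)
  also have "\<dots> \<le> real (l + 1) powr (1 / 4) * C (l + 1) *
      (g powr (real (l + 1) / 2) * (1 / (1 - g)) powr (3 / 4))"
  proof -
    have "(\<Sum>j<n - l. g ^ j) \<le> 1 / (1 - g)"
      unfolding geometric_quotient[OF less_imp_neq[OF g(2)], symmetric]
      using g by (intro divide_right_mono) auto
    then show ?thesis
      using g C_pos[of "l + 1"] by (intro mult_left_mono powr_mono2 sum_nonneg) auto
  qed
  also have "\<dots> = tail_factor l g * g powr (real (l + 1) / 2)"
    using g by (simp add: tail_factor_def powr_divide)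
  finally show ?thesis by (simp add: g_def)
qed

lemma error_le_head:
  assumes "1 \<le> l" "l \<le> n" "n \<le> N"
    and Z: "\<And>j k. j \<in> {1..N} \<Longrightarrow> k \<in> {1..n} \<Longrightarrow> cmod (Z j k) \<le> 1"
  shows "cmod (fact (N - n) / fact N * Per N n Z - H N n Z l) \<le> head_bound l (gamma N n Z)"
proof -
  define g where "g = gamma N n Z"
  have g: "0 \<le> g" using gamma_nonneg[of N n Z] assms by (simp add: g_def)
  have "cmod (Per N n Z) \<le> fact N / fact (N - n)"
    using norm_rperm_le[of "{1..n}" "{1..N}" Z] assms by (simp add: Per_def rperm_def)
  then have "fact (N - n) / fact N * cmod (Per N n Z) \<le> fact (N - n) / fact N * (fact N / fact (N - n))"
    by (intro mult_left_mono) auto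
  then have per: "cmod (fact (N - n) / fact N * Per N n Z) \<le> 1"
    by (simp add: norm_mult norm_divide)
  have zero: "cmod (G N n Z 0) \<le> 1"
  proof -
    have "cmod (G N n Z 0) = (\<Prod>k\<in>{1..n}. cmod (zbar N Z k))" by (simp add: G_0 prod_norm)
    also have "\<dots> \<le> 1" using norm_zbar_le[of N Z] assms by (intro prod_le_1) auto
    finally show ?thesis .
  qed
  have "{0..l} = insert 0 (insert 1 {2..<2 + (l - 1)})" using assms by auto
  then have H_eq: "H N n Z l = G N n Z 0 + (\<Sum>m\<in>{2..<2 + (l - 1)}. G N n Z m)"
    using G_1[of n N Z] assms by (simp add: H_def)
  have "cmod (H N n Z l) \<le> 1 + (\<Sum>m\<in>{2..<2 + (l - 1)}. cmod (G N n Z m))"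
    unfolding H_eq by (rule norm_triangle_le[OF add_mono[OF zero norm_sum]])
  also have "(\<Sum>m\<in>{2..<2 + (l - 1)}. cmod (G N n Z m)) \<le> real 2 powr (1 / 4) * C 2 *
      (g powr (real 2 / 2) * (\<Sum>j<l - 1. g ^ j) powr (3 / 4))"
    unfolding g_def by (rule sum_G_le) (use assms in auto)
  finally have "cmod (H N n Z l) \<le> head_bound l g - 1"
    using g by (simp add: head_bound_def)
  then show ?thesis
    using norm_triangle_ineq4[of "fact (N - n) / fact N * Per N n Z" "H N n Z l"] per
    unfolding g_def by linarith
qed

text \<open>
  Below the crossing point \<open>xsol l\<close> the increasing tail factor is at most its value there; above it
  the decreasing ratio is at most the same value.
\<close>
lemma tail_factor_xsol_admissible:
  assumes "l \<ge> 1"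
  shows "tail_factor l (xsol l) \<in> admissible l"
  unfolding admissible_def
proof (intro CollectI allI impI)
  fix N n Z
  assume "1 \<le> N \<and> n \<in> {1..N} \<and> l \<le> n \<and> (\<forall>j\<in>{1..N}. \<forall>k\<in>{1..n}. cmod (Z j k) \<le> 1)"
  then have n: "l \<le> n" "n \<le> N" "1 \<le> n" "1 \<le> N"
    and Z: "\<And>j k. j \<in> {1..N} \<Longrightarrow> k \<in> {1..n} \<Longrightarrow> cmod (Z j k) \<le> 1" by auto
  let ?E = "cmod (fact (N - n) / fact N * Per N n Z - H N n Z l)"
  define g where "g = gamma N n Z"
  have g: "0 \<le> g" "g \<le> 1"
    unfolding g_def using gamma_nonneg[of N n Z] gamma_le_1[of n N Z] n Z by auto
  note x = xsol_props[OF assms]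
  show "?E \<le> tail_factor l (xsol l) * gamma N n Z powr (real (l + 1) / 2)"
  proof (cases "g < xsol l")
    case True
    then have "?E \<le> tail_factor l g * g powr (real (l + 1) / 2)"
      unfolding g_def by (intro error_le_tail[OF assms n(1,2)] Z) (use x(2) in auto)
    also have "\<dots> \<le> tail_factor l (xsol l) * g powr (real (l + 1) / 2)"
      using tail_factor_strict_mono[OF True x(2), of l] by (intro mult_right_mono) auto
    finally show ?thesis by (simp add: g_def)
  next
    case False
    then have le: "xsol l \<le> g" by simp
    then have pos: "g powr (real (l + 1) / 2) > 0" using x(1) by simp
    have "?E \<le> head_bound l g"
      unfolding g_def by (rule error_le_head[OF assms n(1,2)]) (rule Z)
    also have "\<dots> = head_bound l g / g powr (real (l + 1) / 2) * g powr (real (l + 1) / 2)"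
      using pos by simp
    also have "\<dots> \<le> tail_factor l (xsol l) * g powr (real (l + 1) / 2)"
      using head_ratio_antimono[OF x(1) le g(2) assms] pos unfolding x(3)
      by (intro mult_right_mono) auto
    finally show ?thesis by (simp add: g_def)
  qed
qed

text \<open>
  One matrix with positive \<open>\<gamma>\<close> forces the constant to be nonnegative. Ones in the first row and
  zeros elsewhere give such a matrix at any size with at least two rows.
\<close>
lemma admissible_nonneg:
  assumes "c \<in> admissible l"
  shows "c \<ge> 0"
proof -
  define N where "N = l + 2"
  define Z :: "nat \<Rightarrow> nat \<Rightarrow> complex" where "Z = (\<lambda>j k. if j = 1 then 1 else 0)"
  have N: "N \<ge> 2" "l \<le> N" by (simp_all add: N_def)
  have zbar: "zbar N Z k = 1 / of_nat N" for k
    using N by (simp add: zbar_def Z_def)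
  have alpha: "alpha N N Z > 0"
  proof -
    have "0 < (cmod (acoef N Z 1 1))\<^sup>2"
      unfolding acoef_def zbar using N by (simp add: Z_def field_simps)
    also have "\<dots> \<le> (\<Sum>k\<in>{1..N}. (cmod (acoef N Z 1 k))\<^sup>2)"
      by (rule member_le_sum) (use N in auto)
    also have "\<dots> \<le> (\<Sum>j\<in>{1..N}. \<Sum>k\<in>{1..N}. (cmod (acoef N Z j k))\<^sup>2)"
      by (rule member_le_sum[of 1 "{1..N}" "\<lambda>j. \<Sum>k\<in>{1..N}. (cmod (acoef N Z j k))\<^sup>2"])
        (use N in \<open>auto intro: sum_nonneg\<close>)
    finally show ?thesis using N by (simp add: alpha_def)
  qed
  have beta: "beta N N Z < 1"
  proof -
    have "alpha N N Z + beta N N Z \<le> 1"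
      by (rule alpha_plus_beta_le) (use N in \<open>auto simp: Z_def\<close>)
    then show ?thesis using alpha by linarith
  qed
  have gamma: "gamma N N Z > 0"
    using alpha beta N by (simp add: gamma_def)
  have "0 \<le> cmod (fact (N - N) / fact N * Per N N Z - H N N Z l)" by simp
  also have "\<dots> \<le> c * gamma N N Z powr (real (l + 1) / 2)"
  proof -
    have "1 \<le> N \<and> N \<in> {1..N} \<and> l \<le> N \<and> (\<forall>j\<in>{1..N}. \<forall>k\<in>{1..N}. cmod (Z j k) \<le> 1)"
      using N by (auto simp: Z_def)
    then show ?thesis using assms unfolding admissible_def by blast
  qed
  finally show ?thesis using gamma by (simp add: zero_le_mult_iff)
qed

text \<open>
  Admissibility is an intersection of closed half-lines, so the infimum is a smallest constant.
\<close>
lemma closed_admissible: "closed (admissible l)"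
proof -
  have eq: "admissible l = (\<Inter>N. \<Inter>n. \<Inter>Z. {c. 1 \<le> N \<and> n \<in> {1..N} \<and> l \<le> n \<and>
      (\<forall>j\<in>{1..N}. \<forall>k\<in>{1..n}. cmod (Z j k) \<le> 1) \<longrightarrow>
      cmod (fact (N - n) / fact N * Per N n Z - H N n Z l)
       \<le> c * gamma N n Z powr (real (l + 1) / 2)})"
    unfolding admissible_def by blast
  have *: "closed {c :: real. P \<longrightarrow> e \<le> c * w}" for P e w
    by (cases P) (auto intro!: closed_Collect_le continuous_intros)
  show ?thesis unfolding eq by (intro closed_INT ballI *)
qed

lemma kappa_least:
  assumes "l \<ge> 1"
  shows "kappa l \<in> admissible l" and "\<And>c. c \<in> admissible l \<Longrightarrow> kappa l \<le> c"
proof -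
  have bdd: "bdd_below (admissible l)" using admissible_nonneg by (rule bdd_belowI)
  have Inf_mem: "Inf (admissible l) \<in> admissible l"
    by (rule closed_contains_Inf)
      (use tail_factor_xsol_admissible[OF assms] bdd closed_admissible in auto)
  have Inf_le: "Inf (admissible l) \<le> c" if "c \<in> admissible l" for c
    using that bdd by (rule cInf_lower)
  have "kappa l = Inf (admissible l)"
    unfolding kappa_def using Inf_mem Inf_le by (rule Least_equality)
  then show "kappa l \<in> admissible l" "\<And>c. c \<in> admissible l \<Longrightarrow> kappa l \<le> c"
    using Inf_mem Inf_le by simp_all
qed

lemma kappa_le: "l \<ge> 1 \<Longrightarrow> kappa l \<le> tail_factor l (xsol l)"
  using kappa_least(2) tail_factor_xsol_admissible by blast

lemma scaled_C_power4:
  assumes "r \<ge> 1"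
  shows "(real r powr (1 / 4) * C r) ^ 4 = (exp 1 ^ r * fact r / real r ^ r)\<^sup>2"
proof -
  have "(real r powr (1 / 4)) ^ 4 = (sqrt (real r))\<^sup>2" using assms by (simp add: powr_power)
  then have "(real r powr (1 / 4) * C r) ^ 4 = ((C r)\<^sup>2 * sqrt (real r))\<^sup>2"
    by (simp add: power_mult_distrib)
  also have "\<dots> = (exp 1 ^ r * fact r / real r ^ r)\<^sup>2"
    unfolding C_square[OF assms] by (simp add: exp_of_nat_mult[symmetric])
  finally show ?thesis .
qed

text \<open>
  The estimate \<open>e < 2.72\<close> is precise enough for the three numerical values.
\<close>
lemma scaled_C_power4_le:
  assumes "r \<ge> 1"
  shows "(real r powr (1 / 4) * C r) ^ 4 \<le> ((272 / 100) ^ r * fact r / real r ^ r)\<^sup>2"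
  unfolding scaled_C_power4[OF assms]
  using e_less_272 by (intro power_mono divide_right_mono mult_right_mono) auto

text \<open>
  The fourth power removes all roots, so that numerical instances become inequalities of rationals.
\<close>
lemma tail_factor_le:
  assumes "l \<ge> 1" "y < 1" "t \<ge> 0"
    and "((272 / 100) ^ (l + 1) * fact (l + 1) / real (l + 1) ^ (l + 1))\<^sup>2 \<le> t ^ 4 * (1 - y) ^ 3"
  shows "tail_factor l y \<le> t"
proof -
  have "(real (l + 1) powr (1 / 4) * C (l + 1)) ^ 4 \<le> t ^ 4 * (1 - y) ^ 3"
    using scaled_C_power4_le[of "l + 1"] assms(4) by linarith
  also have "\<dots> = (t * (1 - y) powr (3 / 4)) ^ 4"
    using assms(2) by (simp add: power_mult_distrib powr_power)
  finally have "real (l + 1) powr (1 / 4) * C (l + 1) \<le> t * (1 - y) powr (3 / 4)"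
    by (rule power_le_imp_le_base[of _ 3, simplified]) (use assms in simp)
  then show ?thesis using assms(2) by (simp add: tail_factor_def divide_le_eq)
qed

text \<open>
  The number \<open>1.9234\<close> is slightly larger than \<open>2.72 / 2\<^sup>1\<^sup>/\<^sup>2\<close>.
\<close>
lemma scaled_C_2_le: "2 powr (1 / 4) * C 2 \<le> 1.9234"
proof -
  have "(2 powr (1 / 4) * C 2) ^ 4 \<le> 1.9234 ^ 4"
    using scaled_C_power4_le[of 2] by (simp add: fact_numeral power_divide)
  then show ?thesis by (rule power_le_imp_le_base[of _ 3, simplified]) simp
qed

lemma head_bound_le:
  assumes "0 \<le> y" "(\<Sum>j<l - 1. y ^ j) powr (3 / 4) \<le> q"
  shows "head_bound l y \<le> 2 + 1.9234 * y * q"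
  unfolding head_bound_def using assms C_pos[of 2]
  by (intro add_left_mono mult_mono scaled_C_2_le) auto

text \<open>
  In this and the next two lemmas, the point at which both functions are evaluated lies close to the
  solution of the equation, which is about \<open>0.5611\<close>, \<open>0.7222\<close> and \<open>0.7812\<close>, respectively.
\<close>
lemma kappa_1_le: "kappa 1 \<le> 3.57"
proof -
  have "tail_factor 1 (xsol 1) \<le> 3.57"
  proof (rule tail_factor_xsol_le[where y = "0.561"])
    show "tail_factor 1 0.561 \<le> 3.57"
      by (rule tail_factor_le) (simp_all add: fact_numeral power_divide)
  qed (simp_all add: head_bound_def)
  then show ?thesis using kappa_le[of 1] by simp
qed

lemma kappa_2_le: "kappa 2 \<le> 5.53"
proof -
  have "tail_factor 2 (xsol 2) \<le> 5.53"
  proof (rule tail_factor_xsol_le[where y = "0.7219"])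
    show "tail_factor 2 0.7219 \<le> 5.53"
      by (rule tail_factor_le) (simp_all add: fact_numeral power_divide)
    have "(0.6133::real)\<^sup>2 \<le> (0.7219 powr (3 / 2))\<^sup>2"
      by (simp add: powr_power power_divide)
    then have "(0.6133::real) \<le> 0.7219 powr (3 / 2)"
      by (rule power2_le_imp_le) simp
    then have "head_bound 2 0.7219 / 0.7219 powr (3 / 2) \<le> (2 + 1.9234 * 0.7219) / 0.6133"
      using head_bound_le[of "0.7219" 2 1] by (intro frac_le) simp_all
    also have "(2 + 1.9234 * 0.7219) / 0.6133 \<le> (5.53::real)" by simp
    finally show "head_bound 2 0.7219 / 0.7219 powr (real (2 + 1) / 2) \<le> 5.53"
      by simp
  qed simp_all
  then show ?thesis using kappa_le[of 2] by simp
qed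

lemma kappa_3_le: "kappa 3 \<le> 7.08"
proof -
  have "tail_factor 3 (xsol 3) \<le> 7.08"
  proof (rule tail_factor_xsol_le[where y = "0.781"])
    show "tail_factor 3 0.781 \<le> 7.08"
      by (rule tail_factor_le) (simp_all add: fact_numeral power_divide)
    have "((1.781::real) powr (3 / 4)) ^ 4 \<le> 1.542 ^ 4"
      by (simp add: powr_power power_divide)
    then have "(1.781::real) powr (3 / 4) \<le> 1.542"
      by (rule power_le_imp_le_base[of _ 3, simplified]) simp
    then have "head_bound 3 0.781 \<le> 2 + 1.9234 * 0.781 * 1.542"
      by (intro head_bound_le) (simp_all add: numeral_2_eq_2)
    then have "head_bound 3 0.781 / 0.781 powr 2 \<le> (2 + 1.9234 * 0.781 * 1.542) / 0.781 powr 2"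
      by (rule divide_right_mono) simp
    then show "head_bound 3 0.781 / 0.781 powr (real (3 + 1) / 2) \<le> 7.08"
      by (simp add: powr_numeral power_divide)
  qed simp_all
  then show ?thesis using kappa_le[of 3] by simp
qed

theorem theorem2p13:
  "(\<forall>l\<ge>1.
      (kappa l \<in> admissible l \<and> (\<forall>c\<in>admissible l. kappa l \<le> c)) \<and>
      (\<exists>!x. x \<in> {0<..<1} \<and> solves_eq l x) \<and>
      kappa l \<le> real (l + 1) powr (1 / 4) * C (l + 1) / (1 - xsol l) powr (3 / 4)) \<and>
   kappa 1 \<le> 3.57 \<and> kappa 2 \<le> 5.53 \<and> kappa 3 \<le> 7.08"
proof (intro conjI allI impI ballI kappa_1_le kappa_2_le kappa_3_le)
  fix l :: nat assume l: "1 \<le> l"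
  show "kappa l \<in> admissible l" by (rule kappa_least(1)[OF l])
  show "kappa l \<le> c" if "c \<in> admissible l" for c by (rule kappa_least(2)[OF l that])
  show "\<exists>!x. x \<in> {0<..<1} \<and> solves_eq l x" by (rule ex1_solution[OF l])
  show "kappa l \<le> real (l + 1) powr (1 / 4) * C (l + 1) / (1 - xsol l) powr (3 / 4)"
    using kappa_le[OF l] unfolding tail_factor_def .
qed

end
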